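(* There exist polynomial-size FO-rewritings for all CQs and ontologies of depth $1$ (i.e., there is a polynomial $p$ such that every CQ ${\boldsymbol q}$ and every ontology $\mathcal{T}$ of depth $1$ have an FO-rewriting of size at most $p(|{\boldsymbol q}|+|\mathcal{T}|)$) if and only if all functions in $\textsc{NL}/\text{poly}$ are computed by polynomial-size Boolean formulas, that is, iff $\textsc{NL}/\text{poly}\subseteq\textsc{NC}^1$.
   Context: An ontology $\mathcal{T}$ is a finite set of tgds $\forall \vec{x}\,(\varphi(\vec{x}) \to \exists \vec{y} \bigwedge_i \psi_i(\vec{x},\vec{y}))$ with $\varphi,\psi_i$ unary or binary atoms without constants and $|\vec{x}\cup\vec{y}|\le 2$; $|\mathcal{T}|$ is the number of predicate occurrences. A data instance $\mathcal{A}$ is a finite set of ground atoms with constants $\mathsf{ind}(\mathcal{A})$; it is complete if every ground atom over $\mathsf{ind}(\mathcal{A})$ entailed by $\mathcal{T},\mathcal{A}$ is in $\mathcal{A}$. A CQ ${\boldsymbol q}(\vec{x})=\exists\vec{y}\,\varphi(\vec{x},\vec{y})$ has $\varphi$ a conjunction of unary/binary atoms over variables (no constants); $|{\boldsymbol q}|$ is its number of atoms. An FO-rewriting of ${\boldsymbol q}(\vec{x})$ and $\mathcal{T}$ is a first-order formula ${\boldsymbol q}'(\vec{x})$ without constants such that for every complete $\mathcal{A}$ and $\vec{a}\subseteq\mathsf{ind}(\mathcal{A})$: $\mathcal{T},\mathcal{A}\models{\boldsymbol q}(\vec{a})$ (truth in all models of $\mathcal{T}\cup\mathcal{A}$) iff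 $\mathcal{A}\models{\boldsymbol q}'(\vec{a})$; its size is its length. For $\varrho(x)$ of the form $S(x)$, $S(x,x)$, $\exists y\,S(x,y)$ or $\exists y\,S(y,x)$ with $S$ in $\mathcal{T}$, $\mathcal{C}_\mathcal{T}^{\varrho(a)}$ is the canonical model (chase) of $(\mathcal{T}\cup\{A(x)\to\varrho(x)\},\{A(a)\})$ with $A$ fresh; $\mathcal{T}$ is of depth $k$ if some $\mathcal{C}_\mathcal{T}^{\varrho(a)}$ contains a chain $R_0(w_0,w_1),\dots,R_{k-1}(w_{k-1},w_k)$ (the $w_i$ not necessarily distinct) but none contains a longer such chain. $\textsc{NL}/\text{poly}$ is the nonuniform class of Boolean functions computable by polynomial-size nondeterministic branching programs; $\textsc{NC}^1$ is the class of Boolean functions computable by polynomial-size Boolean formulas.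
   Formalization: Read literally, no ontology has depth 1 (take ϱ=S(x,x)); here chain steps use a predicate or its inverse and must end in a null, either created at the current element or equal to it. Models range over subsets of one arbitrary infinite set (same entailment by Löwenheim–Skolem). *)

theory Defs
  imports "HOL-Computational_Algebra.Polynomial"
begin

section \<open>Ontologies, data instances and conjunctive queries\<close>

text \<open>The parameter is the type of arguments: variables (in tgds, CQs and formulas), individual
  constants (in data instances), or domain elements (an interpretation of the predicates is the set
  of atoms true in it). Unary and binary predicates are two disjoint countable stocks of names.\<close>

datatype 'a atom = Unary nat 'a | Binary nat 'a 'a

text \<open>All variables of the body are universally quantified; the variables of the head that do not
  occur in the body are existentially quantified.\<close>

datatype tgd = Tgd (body: "nat atom") (head: "nat atom list")

definition tgd_vars :: "tgd \<Rightarrow> nat set" where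
  "tgd_vars \<tau> = set_atom (body \<tau>) \<union> (\<Union>\<psi>\<in>set (head \<tau>). set_atom \<psi>)"

definition ontology :: "tgd set \<Rightarrow> bool" where
  "ontology T \<longleftrightarrow> finite T \<and> (\<forall>\<tau>\<in>T. card (tgd_vars \<tau>) \<le> 2)"

definition ontology_size :: "tgd set \<Rightarrow> nat" where
  "ontology_size T = (\<Sum>\<tau>\<in>T. 1 + length (head \<tau>))"

definition ind :: "'a atom set \<Rightarrow> 'a set" where
  "ind A = (\<Union>\<alpha>\<in>A. set_atom \<alpha>)"

datatype cq = CQ (answer_vars: "nat list") (cq_atoms: "nat atom list")

definition wf_cq :: "cq \<Rightarrow> bool" where
  "wf_cq q \<longleftrightarrow> distinct (answer_vars q) \<and>
     set (answer_vars q) \<subseteq> (\<Union>\<alpha>\<in>set (cq_atoms q). set_atom \<alpha>)"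

definition cq_size :: "cq \<Rightarrow> nat" where
  "cq_size q = length (cq_atoms q)"


section \<open>Models and certain answers\<close>

definition sat_tgd :: "'d set \<Rightarrow> 'd atom set \<Rightarrow> tgd \<Rightarrow> bool" where
  "sat_tgd D I \<tau> \<longleftrightarrow> (\<forall>\<nu>. range \<nu> \<subseteq> D \<longrightarrow> map_atom \<nu> (body \<tau>) \<in> I \<longrightarrow>
     (\<exists>\<mu>. range \<mu> \<subseteq> D \<and> (\<forall>v\<in>set_atom (body \<tau>). \<mu> v = \<nu> v) \<and>
          (\<forall>\<psi>\<in>set (head \<tau>). map_atom \<mu> \<psi> \<in> I)))"

text \<open>First-order structures with domain \<open>D\<close>, interpretation \<open>c\<close> of the individual constants and
  interpretation \<open>I\<close> of the predicates.\<close>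

definition is_model ::
  "tgd set \<Rightarrow> nat atom set \<Rightarrow> 'd set \<Rightarrow> (nat \<Rightarrow> 'd) \<Rightarrow> 'd atom set \<Rightarrow> bool" where
  "is_model T A D c I \<longleftrightarrow> D \<noteq> {} \<and> range c \<subseteq> D \<and> ind I \<subseteq> D \<and>
     (\<forall>\<tau>\<in>T. sat_tgd D I \<tau>) \<and> (\<forall>\<alpha>\<in>A. map_atom c \<alpha> \<in> I)"

definition sat_cq :: "'d set \<Rightarrow> 'd atom set \<Rightarrow> cq \<Rightarrow> 'd list \<Rightarrow> bool" where
  "sat_cq D I q ds \<longleftrightarrow> (\<exists>\<mu>. range \<mu> \<subseteq> D \<and> map \<mu> (answer_vars q) = ds \<and>
     (\<forall>\<alpha>\<in>set (cq_atoms q). map_atom \<mu> \<alpha> \<in> I))"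

text \<open>HOL cannot quantify over all types inside a formula, so the models considered are those whose
  domain is a nonempty subset of the type given as the first argument. By the
  Loewenheim-Skolem theorem any infinite type yields the usual notion of entailment.\<close>

definition entails_atom :: "'d itself \<Rightarrow> tgd set \<Rightarrow> nat atom set \<Rightarrow> nat atom \<Rightarrow> bool" where
  "entails_atom _ T A \<alpha> \<longleftrightarrow>
     (\<forall>(D :: 'd set) c I. is_model T A D c I \<longrightarrow> map_atom c \<alpha> \<in> I)"

definition entails_cq ::
  "'d itself \<Rightarrow> tgd set \<Rightarrow> nat atom set \<Rightarrow> cq \<Rightarrow> nat list \<Rightarrow> bool" where
  "entails_cq _ T A q as \<longleftrightarrow>
     (\<forall>(D :: 'd set) c I. is_model T A D c I \<longrightarrow> sat_cq D I q (map c as))"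

definition complete_instance :: "'d itself \<Rightarrow> tgd set \<Rightarrow> nat atom set \<Rightarrow> bool" where
  "complete_instance d T A \<longleftrightarrow>
     (\<forall>\<alpha>. set_atom \<alpha> \<subseteq> ind A \<longrightarrow> entails_atom d T A \<alpha> \<longrightarrow> \<alpha> \<in> A)"


section \<open>First-order rewritings\<close>

datatype fo =
    FAtom "nat atom"
  | FEq nat nat
  | FNot fo
  | FAnd fo fo
  | FOr fo fo
  | FEx nat fo
  | FAll nat fo

fun fo_free :: "fo \<Rightarrow> nat set" where
  "fo_free (FAtom \<alpha>) = set_atom \<alpha>"
| "fo_free (FEq x y) = {x, y}"
| "fo_free (FNot \<phi>) = fo_free \<phi>"
| "fo_free (FAnd \<phi> \<psi>) = fo_free \<phi> \<union> fo_free \<psi>"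
| "fo_free (FOr \<phi> \<psi>) = fo_free \<phi> \<union> fo_free \<psi>"
| "fo_free (FEx x \<phi>) = fo_free \<phi> - {x}"
| "fo_free (FAll x \<phi>) = fo_free \<phi> - {x}"

text \<open>Length of a formula, every occurrence of a predicate, variable, connective or quantifier
  counting as one symbol.\<close>

fun fo_size :: "fo \<Rightarrow> nat" where
  "fo_size (FAtom (Unary P x)) = 2"
| "fo_size (FAtom (Binary P x y)) = 3"
| "fo_size (FEq x y) = 3"
| "fo_size (FNot \<phi>) = 1 + fo_size \<phi>"
| "fo_size (FAnd \<phi> \<psi>) = 1 + fo_size \<phi> + fo_size \<psi>"
| "fo_size (FOr \<phi> \<psi>) = 1 + fo_size \<phi> + fo_size \<psi>"
| "fo_size (FEx x \<phi>) = 2 + fo_size \<phi>"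
| "fo_size (FAll x \<phi>) = 2 + fo_size \<phi>"

fun fo_sat :: "'d set \<Rightarrow> 'd atom set \<Rightarrow> (nat \<Rightarrow> 'd) \<Rightarrow> fo \<Rightarrow> bool" where
  "fo_sat D I \<nu> (FAtom \<alpha>) \<longleftrightarrow> map_atom \<nu> \<alpha> \<in> I"
| "fo_sat D I \<nu> (FEq x y) \<longleftrightarrow> \<nu> x = \<nu> y"
| "fo_sat D I \<nu> (FNot \<phi>) \<longleftrightarrow> \<not> fo_sat D I \<nu> \<phi>"
| "fo_sat D I \<nu> (FAnd \<phi> \<psi>) \<longleftrightarrow> fo_sat D I \<nu> \<phi> \<and> fo_sat D I \<nu> \<psi>"
| "fo_sat D I \<nu> (FOr \<phi> \<psi>) \<longleftrightarrow> fo_sat D I \<nu> \<phi> \<or> fo_sat D I \<nu> \<psi>"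
| "fo_sat D I \<nu> (FEx x \<phi>) \<longleftrightarrow> (\<exists>d\<in>D. fo_sat D I (\<nu>(x := d)) \<phi>)"
| "fo_sat D I \<nu> (FAll x \<phi>) \<longleftrightarrow> (\<forall>d\<in>D. fo_sat D I (\<nu>(x := d)) \<phi>)"

text \<open>The data instance \<open>A\<close> is itself a structure with domain \<open>ind A\<close>. A tuple of individuals is
  given by an assignment \<open>\<nu>\<close> to the (distinct) answer variables.\<close>

definition fo_rewriting :: "'d itself \<Rightarrow> cq \<Rightarrow> tgd set \<Rightarrow> fo \<Rightarrow> bool" where
  "fo_rewriting d q T \<phi> \<longleftrightarrow> fo_free \<phi> \<subseteq> set (answer_vars q) \<and>
     (\<forall>A \<nu>. finite A \<longrightarrow> complete_instance d T A \<longrightarrow> \<nu> ` set (answer_vars q) \<subseteq> ind A \<longrightarrow>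
        (entails_cq d T A q (map \<nu> (answer_vars q)) \<longleftrightarrow> fo_sat (ind A) A \<nu> \<phi>))"


section \<open>Canonical models and depth\<close>

text \<open>\<open>Null \<tau> y \<beta>\<close> is the labelled null introduced for the existential variable \<open>y\<close> when \<open>\<tau>\<close> is
  applied to the instance \<open>\<beta>\<close> of its body.\<close>

datatype elem = Ind nat | Null tgd nat "elem atom"

definition head_satisfied :: "elem atom set \<Rightarrow> tgd \<Rightarrow> (nat \<Rightarrow> elem) \<Rightarrow> bool" where
  "head_satisfied C \<tau> \<nu> \<longleftrightarrow>
     (\<exists>\<mu>. (\<forall>v\<in>set_atom (body \<tau>). \<mu> v = \<nu> v) \<and> (\<forall>\<psi>\<in>set (head \<tau>). map_atom \<mu> \<psi> \<in> C))"

definition with_nulls :: "tgd \<Rightarrow> (nat \<Rightarrow> elem) \<Rightarrow> nat \<Rightarrow> elem" where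
  "with_nulls \<tau> \<nu> v =
     (if v \<in> set_atom (body \<tau>) then \<nu> v else Null \<tau> v (map_atom \<nu> (body \<tau>)))"

text \<open>The standard (restricted) chase, in its order-independent form: each round applies in parallel
  all tgds to all instances of their bodies for which the head does not hold yet.\<close>

definition chase_step :: "tgd set \<Rightarrow> elem atom set \<Rightarrow> elem atom set" where
  "chase_step T C = C \<union> {map_atom (with_nulls \<tau> \<nu>) \<psi> | \<tau> \<nu> \<psi>.
     \<tau> \<in> T \<and> map_atom \<nu> (body \<tau>) \<in> C \<and> \<not> head_satisfied C \<tau> \<nu> \<and> \<psi> \<in> set (head \<tau>)}"

definition chase :: "tgd set \<Rightarrow> nat atom set \<Rightarrow> elem atom set" where
  "chase T A = (\<Union>n. (chase_step T ^^ n) (map_atom Ind ` A))"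

definition unary_preds :: "tgd set \<Rightarrow> nat set" where
  "unary_preds T = {P. \<exists>\<tau>\<in>T. \<exists>x. Unary P x \<in> insert (body \<tau>) (set (head \<tau>))}"

definition binary_preds :: "tgd set \<Rightarrow> nat set" where
  "binary_preds T = {P. \<exists>\<tau>\<in>T. \<exists>x y. Binary P x y \<in> insert (body \<tau>) (set (head \<tau>))}"

text \<open>The formulas \<open>\<rho>(x)\<close>, with \<open>x\<close> the variable \<open>0\<close> and \<open>y\<close> the existentially quantified
  variable \<open>1\<close>. In \<open>canonical_model\<close> below, \<open>F\<close> is the fresh unary predicate and \<open>a\<close> is
  the constant \<open>0\<close>.\<close>

definition generators :: "tgd set \<Rightarrow> nat atom set" where
  "generators T = {Unary S 0 | S. S \<in> unary_preds T} \<union>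
     (\<Union>S\<in>binary_preds T. {Binary S 0 0, Binary S 0 1, Binary S 1 0})"

definition canonical_model :: "tgd set \<Rightarrow> nat \<Rightarrow> nat atom \<Rightarrow> elem atom set" where
  "canonical_model T F \<rho> = chase (insert (Tgd (Unary F 0) [\<rho>]) T) {Unary F 0}"

text \<open>One step \<open>R(w, w')\<close> of a chain, where \<open>R\<close> is a binary predicate or the inverse of one.
  Chains go along the generation of nulls: \<open>w'\<close> is a null, and it is either created at \<open>w\<close> or
  \<open>w\<close> itself, so a null with a loop starts an infinite chain. What is not allowed is to step back
  from a null to the element it was created at, or to loop at the individual. With such steps a
  chain could run through \<open>R(a, w)\<close>, \<open>R'(w, a)\<close> or \<open>S(a, a)\<close> forever; as \<open>S(x, x)\<close> is among the
  formulas \<open>\<rho>(x)\<close>, no ontology at all would be of depth \<open>1\<close>.\<close>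

definition created_at :: "elem \<Rightarrow> elem \<Rightarrow> bool" where
  "created_at w w' \<longleftrightarrow> (\<exists>\<tau> y \<beta>. w' = Null \<tau> y \<beta> \<and> w \<in> set_atom \<beta>)"

definition chain_link :: "elem atom set \<Rightarrow> elem \<Rightarrow> elem \<Rightarrow> bool" where
  "chain_link C w w' \<longleftrightarrow> (\<exists>R. Binary R w w' \<in> C \<or> Binary R w' w \<in> C) \<and>
     w' \<notin> range Ind \<and> (created_at w w' \<or> w' = w)"

definition has_chain :: "tgd set \<Rightarrow> nat \<Rightarrow> bool" where
  "has_chain T k \<longleftrightarrow> (\<exists>F \<rho> w. F \<notin> unary_preds T \<and> \<rho> \<in> generators T \<and>
     (\<forall>i<k. chain_link (canonical_model T F \<rho>) (w i) (w (Suc i))))"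

definition of_depth :: "tgd set \<Rightarrow> nat \<Rightarrow> bool" where
  "of_depth T k \<longleftrightarrow> has_chain T k \<and> (\<forall>m>k. \<not> has_chain T m)"


section \<open>Nondeterministic branching programs and Boolean formulas\<close>

text \<open>A family of Boolean functions, one for each number \<open>n\<close> of variables, is a function
  \<open>f :: bool list \<Rightarrow> bool\<close>; its restriction to lists of length \<open>n\<close> is the \<open>n\<close>-ary member.\<close>

datatype label = LConst bool | LPos nat | LNeg nat

fun label_vars :: "label \<Rightarrow> nat set" where
  "label_vars (LConst b) = {}"
| "label_vars (LPos i) = {i}"
| "label_vars (LNeg i) = {i}"

fun label_val :: "bool list \<Rightarrow> label \<Rightarrow> bool" where
  "label_val xs (LConst b) = b"
| "label_val xs (LPos i) = xs ! i"
| "label_val xs (LNeg i) = (\<not> xs ! i)"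

datatype nbp =
  NBP (vertices: "nat set") (arcs: "(nat \<times> label \<times> nat) set") (source: nat) (sink: nat)

definition wf_nbp :: "nat \<Rightarrow> nbp \<Rightarrow> bool" where
  "wf_nbp n B \<longleftrightarrow> finite (vertices B) \<and> source B \<in> vertices B \<and> sink B \<in> vertices B \<and>
     (\<forall>(u, l, v)\<in>arcs B. u \<in> vertices B \<and> v \<in> vertices B \<and> label_vars l \<subseteq> {..<n})"

definition nbp_size :: "nbp \<Rightarrow> nat" where
  "nbp_size B = card (vertices B) + card (arcs B)"

definition nbp_accepts :: "nbp \<Rightarrow> bool list \<Rightarrow> bool" where
  "nbp_accepts B xs \<longleftrightarrow>
     (source B, sink B) \<in> {(u, v). \<exists>l. (u, l, v) \<in> arcs B \<and> label_val xs l}\<^sup>*"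

definition NL_poly :: "(bool list \<Rightarrow> bool) set" where
  "NL_poly = {f. \<exists>p :: nat poly. \<forall>n. \<exists>B. wf_nbp n B \<and> nbp_size B \<le> poly p n \<and>
     (\<forall>xs. length xs = n \<longrightarrow> nbp_accepts B xs = f xs)}"

datatype bform = BConst bool | BVar nat | BNot bform | BAnd bform bform | BOr bform bform

fun bform_vars :: "bform \<Rightarrow> nat set" where
  "bform_vars (BConst b) = {}"
| "bform_vars (BVar i) = {i}"
| "bform_vars (BNot \<phi>) = bform_vars \<phi>"
| "bform_vars (BAnd \<phi> \<psi>) = bform_vars \<phi> \<union> bform_vars \<psi>"
| "bform_vars (BOr \<phi> \<psi>) = bform_vars \<phi> \<union> bform_vars \<psi>"

fun bform_val :: "bool list \<Rightarrow> bform \<Rightarrow> bool" where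
  "bform_val xs (BConst b) = b"
| "bform_val xs (BVar i) = xs ! i"
| "bform_val xs (BNot \<phi>) = (\<not> bform_val xs \<phi>)"
| "bform_val xs (BAnd \<phi> \<psi>) = (bform_val xs \<phi> \<and> bform_val xs \<psi>)"
| "bform_val xs (BOr \<phi> \<psi>) = (bform_val xs \<phi> \<or> bform_val xs \<psi>)"

fun bform_size :: "bform \<Rightarrow> nat" where
  "bform_size (BConst b) = 1"
| "bform_size (BVar i) = 1"
| "bform_size (BNot \<phi>) = 1 + bform_size \<phi>"
| "bform_size (BAnd \<phi> \<psi>) = 1 + bform_size \<phi> + bform_size \<psi>"
| "bform_size (BOr \<phi> \<psi>) = 1 + bform_size \<phi> + bform_size \<psi>"

definition NC1 :: "(bool list \<Rightarrow> bool) set" where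
  "NC1 = {f. \<exists>p :: nat poly. \<forall>n. \<exists>\<phi>. bform_vars \<phi> \<subseteq> {..<n} \<and> bform_size \<phi> \<le> poly p n \<and>
     (\<forall>xs. length xs = n \<longrightarrow> bform_val xs \<phi> = f xs)}"

end

theory Submission
  imports Defs "HOL-Library.Countable"
begin

text \<open>Over a complete data instance and an ontology of depth 1, a match of a CQ in the canonical model
  is determined by the set of variables mapped to nulls. A null below an individual has no neighbour
  but that individual, so no two adjacent variables are selected, all neighbours of a selected variable
  get the same value, and every atom without a selected variable must hold in the data. For fixed
  values of the variables these conditions form a 2-CNF, whose unsatisfiability amounts to the
  existence of certain paths in the implication graph; so reachability formulas, which
  \<open>NL_poly \<subseteq> NC1\<close> provides in polynomial size, yield rewritings. Components mapped to nulls only are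
  entailed by a single data atom, as the bodies of tgds are single atoms, and are treated separately.

  Conversely, with the one-tgd ontology \<open>C(x) \<rightarrow> \<exists>y (B(y) \<and> \<And>\<^sub>R (R(x, y) \<and> R(y, x)))\<close> and data with a
  single individual, the 2-CNF of a suitable query says that the sink of a given branching program is
  not reachable from its source, and over a single individual a first-order formula is a Boolean
  formula.\<close>

text \<open>The obstacle is the choice of the variables mapped to nulls: a disjunction over all
  choices is exponential in the query, whereas the values of the variables are simply quantified in
  the formula. That the choice reduces to a 2-CNF has two sources. A tgd with an existential
  variable has a single body variable, so a null is created at exactly one element; and the absence
  of chains of length 2 excludes further nulls and loops at a null below an individual.

  Both directions meet reachability through its complement, and one negation in the formula corrects
  this.

  A rewriting has to be short, not computable; hence the generators that occur in it can be picked
  by entailment itself. Entailment refers to domains inside an arbitrary infinite type, while the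
  model glued from canonical models lives in a type of its own; that type is countable and therefore
  embeds.\<close>

instance label :: countable
  by countable_datatype

text \<open>Countability of atoms, tgds and elements makes the domain of \<open>glued\<close>
  countable, as \<open>entails_cq_countable\<close> requires. Labels are numbered for the sake of
  \<open>arc_var\<close>.\<close>

instance atom :: (countable) countable
  by countable_datatype

instance tgd :: countable
  by countable_datatype

instance elem :: countable
  by countable_datatype

lemma poly_nat_mono: "x \<le> y \<Longrightarrow> poly p x \<le> poly p y" for p :: "nat poly"
proof (induction p)
  case (pCons a p)
  then show ?case by (simp add: mult_mono)
qed simp

section \<open>The chase\<close>

lemma chase_induct [consumes 1, case_names base step]:
  assumes "\<alpha> \<in> chase T A"
    and base: "\<And>\<alpha>. \<alpha> \<in> A \<Longrightarrow> P (map_atom Ind \<alpha>)"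
    and step: "\<And>\<tau> \<nu> \<psi>. \<tau> \<in> T \<Longrightarrow> map_atom \<nu> (body \<tau>) \<in> chase T A \<Longrightarrow> P (map_atom \<nu> (body \<tau>)) \<Longrightarrow>
      \<psi> \<in> set (head \<tau>) \<Longrightarrow> P (map_atom (with_nulls \<tau> \<nu>) \<psi>)"
  shows "P \<alpha>"
proof -
  have "\<forall>\<alpha>\<in>(chase_step T ^^ n) (map_atom Ind ` A). P \<alpha>" for n
  proof (induction n)
    case 0
    then show ?case using base by auto
  next
    case (Suc n)
    let ?C = "(chase_step T ^^ n) (map_atom Ind ` A)"
    have sub: "?C \<subseteq> chase T A" unfolding chase_def by blast
    show ?case
    proof
      fix \<alpha> assume "\<alpha> \<in> (chase_step T ^^ Suc n) (map_atom Ind ` A)"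
      then consider "\<alpha> \<in> ?C" | \<tau> \<nu> \<psi> where "\<alpha> = map_atom (with_nulls \<tau> \<nu>) \<psi>" "\<tau> \<in> T"
          "map_atom \<nu> (body \<tau>) \<in> ?C" "\<psi> \<in> set (head \<tau>)"
        unfolding funpow.simps o_apply chase_step_def by blast
      then show "P \<alpha>"
      proof cases
        case 1
        then show ?thesis using Suc by blast
      next
        case 2
        then show ?thesis using step[OF 2(2) _ _ 2(4)] Suc sub by blast
      qed
    qed
  qed
  then show ?thesis using assms(1) unfolding chase_def by blast
qed

text \<open>A body is a single atom, so it already holds at some finite stage; if the head does not
  hold there, the next stage adds an instance of it.\<close>

lemma chase_sat_tgd:
  assumes "\<tau> \<in> T"
  shows "sat_tgd UNIV (chase T A) \<tau>"
  unfolding sat_tgd_def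
proof (intro allI impI)
  fix \<nu> assume "map_atom \<nu> (body \<tau>) \<in> chase T A"
  then obtain n where n: "map_atom \<nu> (body \<tau>) \<in> (chase_step T ^^ n) (map_atom Ind ` A)" (is "_ \<in> ?C n")
    unfolding chase_def by blast
  have sub: "?C m \<subseteq> chase T A" for m unfolding chase_def by blast
  show "\<exists>\<mu>. range \<mu> \<subseteq> UNIV \<and> (\<forall>v\<in>set_atom (body \<tau>). \<mu> v = \<nu> v) \<and>
      (\<forall>\<psi>\<in>set (head \<tau>). map_atom \<mu> \<psi> \<in> chase T A)"
  proof (cases "head_satisfied (?C n) \<tau> \<nu>")
    case True
    then show ?thesis unfolding head_satisfied_def using sub by blast
  next
    case False
    have "map_atom (with_nulls \<tau> \<nu>) \<psi> \<in> ?C (Suc n)" if "\<psi> \<in> set (head \<tau>)" for \<psi>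
      using that assms n False unfolding funpow.simps o_apply chase_step_def by blast
    then have "\<forall>\<psi>\<in>set (head \<tau>). map_atom (with_nulls \<tau> \<nu>) \<psi> \<in> chase T A"
      using sub by blast
    moreover have "\<forall>v\<in>set_atom (body \<tau>). with_nulls \<tau> \<nu> v = \<nu> v"
      by (simp add: with_nulls_def)
    ultimately show ?thesis by blast
  qed
qed

text \<open>The null standing for the existential variable of the generator \<open>\<rho>\<close>.\<close>

definition root_null :: "nat \<Rightarrow> nat atom \<Rightarrow> elem" where
  "root_null F \<rho> = Null (Tgd (Unary F 0) [\<rho>]) 1 (Unary F (Ind 0))"

text \<open>Assigns values to the variables of a generator: 0 for the individual and 1 for the other
  argument. The second value is a dummy if 1 does not occur.\<close>

definition at_pair :: "'a \<Rightarrow> 'a \<Rightarrow> nat \<Rightarrow> 'a" where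
  "at_pair a b i = (if i = 0 then a else b)"

lemma comp_at_pair: "f \<circ> at_pair a b = at_pair (f a) (f b)"
  by (auto simp: at_pair_def)

lemma generator_vars: "\<rho> \<in> generators T \<Longrightarrow> 0 \<in> set_atom \<rho> \<and> set_atom \<rho> \<subseteq> {0, 1}"
  by (auto simp: generators_def)

lemma generator_not_fresh: "\<rho> \<in> generators T \<Longrightarrow> F \<notin> unary_preds T \<Longrightarrow> \<rho> \<noteq> Unary F x"
  by (auto simp: generators_def)

text \<open>In the first round the fresh atom is the only one present. It is no instance of
  \<open>\<rho>\<close>, so the fresh tgd fires.\<close>

lemma canonical_model_root:
  assumes "\<rho> \<in> generators T" "F \<notin> unary_preds T"
  shows "map_atom (at_pair (Ind 0) (root_null F \<rho>)) \<rho> \<in> canonical_model T F \<rho>"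
proof -
  let ?\<tau> = "Tgd (Unary F 0) [\<rho>]" and ?C = "{Unary F (Ind 0)}"
  have "\<not> head_satisfied ?C ?\<tau> (\<lambda>_. Ind 0)"
    using generator_not_fresh[OF assms] by (cases \<rho>) (auto simp: head_satisfied_def)
  then have "map_atom (with_nulls ?\<tau> (\<lambda>_. Ind 0)) \<rho> \<in> chase_step (insert ?\<tau> T) ?C"
    unfolding chase_step_def by fastforce
  moreover have "map_atom (with_nulls ?\<tau> (\<lambda>_. Ind 0)) \<rho> = map_atom (at_pair (Ind 0) (root_null F \<rho>)) \<rho>"
    using generator_vars[OF assms(1)]
    by (intro atom.map_cong) (auto simp: with_nulls_def at_pair_def root_null_def)
  ultimately show ?thesis
    unfolding canonical_model_def chase_def by (intro UN_I[of 1]) auto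
qed

section \<open>Reachability as query entailment\<close>

text \<open>Variables of the query that are mapped to the null of the canonical model play the role of
  the reached vertices. The variable of an arc \<open>(u, l, v)\<close> separates those of \<open>u\<close> and \<open>v\<close>: no two
  adjacent variables can be mapped to the null, and if \<open>l\<close> is true then its predicate is missing
  from the data, so that one of the two variables of the second atom must be.\<close>

fun label_pred :: "label \<Rightarrow> nat" where
  "label_pred (LConst b) = (if b then 1 else 0)"
| "label_pred (LPos i) = 2 * i + 2"
| "label_pred (LNeg i) = 2 * i + 3"

lemma label_pred_inj: "label_pred l = label_pred l' \<Longrightarrow> l = l'"
  by (cases l; cases l') (auto split: if_splits, presburger+)

lemma label_pred_less: "label_vars l \<subseteq> {..<n} \<Longrightarrow> label_pred l < 2 * n + 2"
  by (cases l) auto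

text \<open>The unary predicates 0 and 1 are \<open>C\<close> and \<open>B\<close>, and
  \<open>2 * n + 2\<close> is the number of codes of labels over \<open>n\<close> variables. A null
  is joined to its individual by every such predicate in both directions, but never to
  itself.\<close>

definition reach_tgd :: "nat \<Rightarrow> tgd" where
  "reach_tgd n = Tgd (Unary 0 0)
     (Unary 1 1 # concat (map (\<lambda>R. [Binary R 0 1, Binary R 1 0]) [0..<2 * n + 2]))"

text \<open>The loops present are those of the false labels: predicate 0, of the constant false,
  always; predicate 1, of the constant true, never.\<close>

definition reach_data :: "bool list \<Rightarrow> nat atom set" where
  "reach_data xs = insert (Unary 0 0)
     {Binary (label_pred l) 0 0 | l. label_vars l \<subseteq> {..<length xs} \<and> \<not> label_val xs l}"

text \<open>Odd, to stay apart from the variables \<open>2 * v\<close> of the vertices.\<close>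

definition arc_var :: "nat \<times> label \<times> nat \<Rightarrow> nat" where
  "arc_var e = 2 * to_nat e + 1"

text \<open>The unary atoms force the source to the null and the sink to the individual. Predicate 0
  holds on all pairs except the null with itself, so the first atom of an arc only says that
  \<open>u\<close> and the variable of the arc are not both null.\<close>

definition reach_query :: "(nat \<times> label \<times> nat) list \<Rightarrow> nat \<Rightarrow> nat \<Rightarrow> cq" where
  "reach_query es s t = CQ [] (Unary 1 (2 * s) # Unary 0 (2 * t) #
     concat (map (\<lambda>(u, l, v). [Binary 0 (2 * u) (arc_var (u, l, v)),
       Binary (label_pred l) (arc_var (u, l, v)) (2 * v)]) es))"

lemma reach_tgd_head: "set (head (reach_tgd n)) =
    insert (Unary 1 1) (\<Union>R\<in>{..<2 * n + 2}. {Binary R 0 1, Binary R 1 0})"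
  by (auto simp: reach_tgd_def)

lemma reach_tgd_body [simp]: "body (reach_tgd n) = Unary 0 0"
  by (simp add: reach_tgd_def)

lemma reach_query_atoms: "set (cq_atoms (reach_query es s t)) =
    {Unary 1 (2 * s), Unary 0 (2 * t)} \<union> (\<Union>(u, l, v)\<in>set es.
      {Binary 0 (2 * u) (arc_var (u, l, v)), Binary (label_pred l) (arc_var (u, l, v)) (2 * v)})"
  by (auto simp: reach_query_def)

lemma size_reach_query: "cq_size (reach_query es s t) = 2 * length es + 2"
proof -
  have "length (concat (map (\<lambda>(u, l, v). [Binary 0 (2 * u) (arc_var (u, l, v)),
       Binary (label_pred l) (arc_var (u, l, v)) (2 * v)]) es)) = 2 * length es"
    by (induction es) auto
  then show ?thesis by (simp add: cq_size_def reach_query_def)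
qed

lemma size_reach_ontology: "ontology_size {reach_tgd n} = 4 * n + 6"
proof -
  have "length (concat (map (\<lambda>R. [Binary R (0::nat) 1, Binary R 1 0]) Rs)) = 2 * length Rs" for Rs
    by (induction Rs) auto
  then show ?thesis by (simp add: ontology_size_def reach_tgd_def del: upt_Suc)
qed

lemma ontology_reach: "ontology {reach_tgd n}"
proof -
  have "tgd_vars (reach_tgd n) \<subseteq> {0, 1}"
    by (auto simp: tgd_vars_def reach_tgd_head)
  then have "card (tgd_vars (reach_tgd n)) \<le> card {0, 1::nat}"
    by (intro card_mono) auto
  then show ?thesis by (simp add: ontology_def)
qed

lemma unary_preds_reach: "unary_preds {reach_tgd n} = {0, 1}"
  unfolding unary_preds_def by (auto simp: reach_tgd_head)

lemma binary_preds_reach: "binary_preds {reach_tgd n} = {..<2 * n + 2}"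
  unfolding binary_preds_def by (auto simp: reach_tgd_head)

lemma of_depth_reach: "of_depth {reach_tgd n} 1"
proof -
  let ?T = "{reach_tgd n}"
  have "has_chain ?T 1"
  proof -
    let ?\<rho> = "Binary 0 0 1 :: nat atom" and ?F = "2 :: nat"
    let ?w = "at_pair (Ind 0) (root_null ?F ?\<rho>)"
    have \<rho>: "?\<rho> \<in> generators ?T" and F: "?F \<notin> unary_preds ?T"
      by (auto simp: generators_def binary_preds_reach unary_preds_reach)
    have "chain_link (canonical_model ?T ?F ?\<rho>) (?w 0) (?w 1)"
      using canonical_model_root[OF \<rho> F]
      by (auto simp: chain_link_def at_pair_def root_null_def created_at_def)
    then show ?thesis using \<rho> F unfolding has_chain_def by (intro exI[of _ ?F] exI[of _ ?\<rho>] exI[of _ ?w]) auto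
  qed
  moreover have "\<not> has_chain ?T m" if "m > 1" for m
  proof
    assume "has_chain ?T m"
    then obtain F \<rho> w where F: "F \<notin> unary_preds ?T" and \<rho>: "\<rho> \<in> generators ?T"
      and w: "\<forall>i<m. chain_link (canonical_model ?T F \<rho>) (w i) (w (Suc i))"
      unfolding has_chain_def by blast
    \<comment> \<open>Unary predicates other than 1 stay at the individual, so both tgds are applied
      only there; hence every binary atom contains the individual.\<close>
    have inv: "(\<forall>P x. \<alpha> = Unary P x \<longrightarrow> x \<noteq> Ind 0 \<longrightarrow> P = 1) \<and>
        (\<forall>R x y. \<alpha> = Binary R x y \<longrightarrow> x = Ind 0 \<or> y = Ind 0)"
      if "\<alpha> \<in> canonical_model ?T F \<rho>" for \<alpha>
      using that unfolding canonical_model_def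
    proof (induction rule: chase_induct)
      case (base \<alpha>)
      then show ?case by auto
    next
      case (step \<tau> \<nu> \<psi>)
      have F01: "F \<noteq> 0" "F \<noteq> 1" using F by (auto simp: unary_preds_reach)
      from step.hyps(1) consider "\<tau> = Tgd (Unary F 0) [\<rho>]" | "\<tau> = reach_tgd n" by auto
      then show ?case
      proof cases
        case 1
        then have "\<nu> 0 = Ind 0" using step.IH F01 by auto
        then show ?thesis using 1 step.hyps(3) \<rho> by (auto simp: generators_def with_nulls_def)
      next
        case 2
        then have "\<nu> 0 = Ind 0" using step.IH by auto
        then show ?thesis using step.hyps(3) unfolding 2 reach_tgd_head
          by (auto simp: with_nulls_def)
      qed
    qed
    have "chain_link (canonical_model ?T F \<rho>) (w 0) (w 1)" "chain_link (canonical_model ?T F \<rho>) (w 1) (w 2)"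
      using w that by (auto simp: numeral_2_eq_2)
    then have "w 1 \<notin> range Ind" "w 2 \<notin> range Ind"
        "\<exists>R. Binary R (w 1) (w 2) \<in> canonical_model ?T F \<rho> \<or> Binary R (w 2) (w 1) \<in> canonical_model ?T F \<rho>"
      unfolding chain_link_def by auto
    then show False using inv by blast
  qed
  ultimately show ?thesis by (simp add: of_depth_def)
qed

lemma ind_reach_data: "ind (reach_data xs) = {0}"
  by (auto simp: ind_def reach_data_def)

lemma finite_reach_data: "finite (reach_data xs)"
proof (rule finite_subset)
  show "reach_data xs \<subseteq> insert (Unary 0 0) ((\<lambda>R. Binary R 0 0) ` {..<2 * length xs + 2})"
    by (auto simp: reach_data_def dest: label_pred_less)
qed simp

text \<open>A copy of the canonical model of the data inside the given type: \<open>d\<close> is the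
  individual and \<open>e\<close> the null.\<close>

definition two_point_model :: "'d \<Rightarrow> 'd \<Rightarrow> bool list \<Rightarrow> 'd atom set" where
  "two_point_model d e xs = map_atom (\<lambda>_. d) ` reach_data xs \<union>
     insert (Unary 1 e) (\<Union>R\<in>{..<2 * length xs + 2}. {Binary R d e, Binary R e d})"

lemma is_model_two_point:
  assumes "d \<noteq> e"
  shows "is_model {reach_tgd (length xs)} (reach_data xs) {d, e} (\<lambda>_. d) (two_point_model d e xs)"
proof -
  have "sat_tgd {d, e} (two_point_model d e xs) (reach_tgd (length xs))"
    unfolding sat_tgd_def
  proof (intro allI impI)
    fix \<nu> assume "map_atom \<nu> (body (reach_tgd (length xs))) \<in> two_point_model d e xs"
    then have "\<nu> 0 = d" using assms by (auto simp: reach_tgd_def two_point_model_def reach_data_def)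
    then show "\<exists>\<mu>. range \<mu> \<subseteq> {d, e} \<and> (\<forall>v\<in>set_atom (body (reach_tgd (length xs))). \<mu> v = \<nu> v) \<and>
       (\<forall>\<psi>\<in>set (head (reach_tgd (length xs))). map_atom \<mu> \<psi> \<in> two_point_model d e xs)"
      unfolding reach_tgd_head
      by (intro exI[of _ "at_pair d e"]) (auto simp: at_pair_def reach_tgd_def two_point_model_def)
  qed
  then show ?thesis
    by (auto simp: is_model_def two_point_model_def ind_def reach_data_def)
qed

lemma two_elements:
  assumes "infinite (UNIV :: 'd set)"
  shows "\<exists>d e :: 'd. d \<noteq> e"
  using ex_new_if_finite[OF assms, of "{undefined}"] by blast

text \<open>One model refutes all missing atoms: \<open>two_point_model\<close> adds to the data no
  atom over \<open>d\<close> alone.\<close>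

lemma complete_reach_data:
  assumes "infinite (UNIV :: 'd set)"
  shows "complete_instance TYPE('d) {reach_tgd (length xs)} (reach_data xs)"
  unfolding complete_instance_def
proof (intro allI impI)
  fix \<alpha> assume \<alpha>: "set_atom \<alpha> \<subseteq> ind (reach_data xs)"
    and ent: "entails_atom TYPE('d) {reach_tgd (length xs)} (reach_data xs) \<alpha>"
  obtain d e :: 'd where "d \<noteq> e" using two_elements[OF assms] by blast
  then have "map_atom (\<lambda>_. d) \<alpha> \<in> two_point_model d e xs"
    using ent[unfolded entails_atom_def, rule_format, OF is_model_two_point] by blast
  then have "map_atom (\<lambda>_. d) \<alpha> \<in> map_atom (\<lambda>_. d) ` reach_data xs"
    using \<open>d \<noteq> e\<close> by (cases \<alpha>) (auto simp: two_point_model_def)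
  then obtain \<beta> where \<beta>: "\<beta> \<in> reach_data xs" "map_atom (\<lambda>_. d) \<alpha> = map_atom (\<lambda>_. d) \<beta>" by blast
  have "set_atom \<beta> \<subseteq> {0}" using \<beta>(1) ind_reach_data[of xs] unfolding ind_def by blast
  then have "\<alpha> = \<beta>" using \<alpha> \<beta>(2) unfolding ind_reach_data by (cases \<alpha>; cases \<beta>) auto
  then show "\<alpha> \<in> reach_data xs" using \<beta>(1) by simp
qed

lemma entails_reach_query:
  assumes inf: "infinite (UNIV :: 'd set)"
    and es: "\<forall>(u, l, v)\<in>set es. label_vars l \<subseteq> {..<length xs}"
  shows "entails_cq TYPE('d) {reach_tgd (length xs)} (reach_data xs) (reach_query es s t) [] \<longleftrightarrow>
     (s, t) \<notin> {(u, v). \<exists>l. (u, l, v) \<in> set es \<and> label_val xs l}\<^sup>*" (is "?ent \<longleftrightarrow> (s, t) \<notin> ?E\<^sup>*")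
proof
  assume ent: ?ent
  obtain d e :: 'd where de: "d \<noteq> e" using two_elements[OF inf] by blast
  let ?I = "two_point_model d e xs"
  obtain \<mu> where \<mu>: "\<forall>\<alpha>\<in>set (cq_atoms (reach_query es s t)). map_atom \<mu> \<alpha> \<in> ?I"
    using ent[unfolded entails_cq_def, rule_format, OF is_model_two_point[OF de]]
    unfolding sat_cq_def by blast
  have s: "Unary 1 (\<mu> (2 * s)) \<in> ?I" and t: "Unary 0 (\<mu> (2 * t)) \<in> ?I"
    using \<mu> unfolding reach_query_atoms by auto
  have arc: "Binary 0 (\<mu> (2 * u)) (\<mu> (arc_var (u, l, v))) \<in> ?I"
      "Binary (label_pred l) (\<mu> (arc_var (u, l, v))) (\<mu> (2 * v)) \<in> ?I" if "(u, l, v) \<in> set es" for u l v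
    using \<mu> that unfolding reach_query_atoms by fastforce+
  \<comment> \<open>An arc variable next to the null must be the individual; the individual has no
    loop for a true label, so the other end of the arc must be the null.\<close>
  have "\<mu> (2 * v) = e" if "(s, v) \<in> ?E\<^sup>*" for v
    using that
  proof (induction rule: rtrancl_induct)
    case base
    then show ?case using s by (auto simp: two_point_model_def reach_data_def)
  next
    case (step u v)
    then obtain l where l: "(u, l, v) \<in> set es" "label_val xs l" by auto
    have "\<mu> (arc_var (u, l, v)) = d"
      using arc(1)[OF l(1)] step(3) de by (auto simp: two_point_model_def reach_data_def)
    then show ?case
      using arc(2)[OF l(1)] de l(2) by (auto simp: two_point_model_def reach_data_def dest!: label_pred_inj)
  qed
  moreover have "\<mu> (2 * t) = d" using t by (auto simp: two_point_model_def reach_data_def)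
  ultimately show "(s, t) \<notin> ?E\<^sup>*" using de by auto
next
  assume st: "(s, t) \<notin> ?E\<^sup>*"
  show ?ent unfolding entails_cq_def
  proof (intro allI impI)
    fix D :: "'d set" and c I
    assume M: "is_model {reach_tgd (length xs)} (reach_data xs) D c I"
    have "Unary 0 (c 0) \<in> I" using M by (force simp: is_model_def reach_data_def)
    then have "\<exists>\<mu>. range \<mu> \<subseteq> D \<and> (\<forall>v\<in>set_atom (body (reach_tgd (length xs))). \<mu> v = c v) \<and>
        (\<forall>\<psi>\<in>set (head (reach_tgd (length xs))). map_atom \<mu> \<psi> \<in> I)"
      using M unfolding is_model_def sat_tgd_def by (simp add: reach_tgd_def)
    then obtain \<mu> where rng: "range \<mu> \<subseteq> D" and "\<mu> 0 = c 0"
      and hd: "\<forall>\<psi>\<in>set (head (reach_tgd (length xs))). map_atom \<mu> \<psi> \<in> I"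
      by (auto simp: reach_tgd_def)
    define d e where "d = c 0" and "e = \<mu> 1"
    have e: "Unary 1 e \<in> I" "\<And>R. R < 2 * length xs + 2 \<Longrightarrow> Binary R d e \<in> I \<and> Binary R e d \<in> I"
      using hd \<open>\<mu> 0 = c 0\<close> unfolding reach_tgd_head d_def e_def by auto
    have d: "Unary 0 d \<in> I"
      "\<And>l. label_vars l \<subseteq> {..<length xs} \<Longrightarrow> \<not> label_val xs l \<Longrightarrow> Binary (label_pred l) d d \<in> I"
      using M unfolding is_model_def reach_data_def d_def by force+
    have d0: "Binary 0 d d \<in> I" using d(2)[of "LConst False"] by simp
    have D: "d \<in> D" "e \<in> D" using M rng by (auto simp: is_model_def d_def e_def)
    \<comment> \<open>If neither end of an arc is reached, its variable goes to the null, since the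
      second atom could fail at the individual when the label is true. If \<open>u\<close> is
      reached and \<open>v\<close> is not, the label is false and its loop is available.\<close>
    define \<kappa> where "\<kappa> x = (if even x then if (s, x div 2) \<in> ?E\<^sup>* then e else d
       else case from_nat (x div 2) of (u :: nat, l :: label, v) \<Rightarrow>
         if (s, u) \<in> ?E\<^sup>* \<or> (s, v) \<in> ?E\<^sup>* then d else e)" for x
    have \<kappa>v: "\<kappa> (2 * v) = (if (s, v) \<in> ?E\<^sup>* then e else d)" for v by (simp add: \<kappa>_def)
    have \<kappa>a: "\<kappa> (arc_var (u, l, v)) = (if (s, u) \<in> ?E\<^sup>* \<or> (s, v) \<in> ?E\<^sup>* then d else e)" for u l v
      by (simp add: \<kappa>_def arc_var_def)
    have "map_atom \<kappa> \<alpha> \<in> I" if "\<alpha> \<in> set (cq_atoms (reach_query es s t))" for \<alpha>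
    proof -
      from that consider "\<alpha> = Unary 1 (2 * s)" | "\<alpha> = Unary 0 (2 * t)"
        | u l v where "(u, l, v) \<in> set es" "\<alpha> = Binary 0 (2 * u) (arc_var (u, l, v))"
        | u l v where "(u, l, v) \<in> set es" "\<alpha> = Binary (label_pred l) (arc_var (u, l, v)) (2 * v)"
        unfolding reach_query_atoms by auto
      then show ?thesis
      proof cases
        case 1 then show ?thesis using e by (simp add: \<kappa>v)
      next
        case 2 then show ?thesis using d st by (simp add: \<kappa>v)
      next
        case 3 then show ?thesis using e(2)[of 0] d0 by (auto simp: \<kappa>v \<kappa>a)
      next
        case 4
        then have l: "label_vars l \<subseteq> {..<length xs}" using es by auto
        have "label_val xs l \<Longrightarrow> (s, u) \<in> ?E\<^sup>* \<Longrightarrow> (s, v) \<in> ?E\<^sup>*"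
          using 4(1) by (auto intro: rtrancl_into_rtrancl)
        then show ?thesis using 4(2) e(2)[OF label_pred_less[OF l]] d(2)[OF l] by (auto simp: \<kappa>v \<kappa>a)
      qed
    qed
    moreover have "range \<kappa> \<subseteq> D" using D by (auto simp: \<kappa>_def split: prod.splits)
    ultimately show "sat_cq D I (reach_query es s t) (map c [])"
      unfolding sat_cq_def by (intro exI[of _ \<kappa>]) (simp add: reach_query_def)
  qed
qed

text \<open>On a structure with a single element all variables, hence all quantifiers and equalities, can
  be dropped; what remains of a first-order formula over \<open>reach_data xs\<close> depends only on \<open>xs\<close>.\<close>

fun boolean_part :: "nat \<Rightarrow> fo \<Rightarrow> bform" where
  "boolean_part n (FAtom (Unary P x)) = BConst (P = 0)"
| "boolean_part n (FAtom (Binary R x y)) =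
     (if R = 0 then BConst True
      else if R = 1 \<or> R \<ge> 2 * n + 2 then BConst False
      else if even R then BNot (BVar (R div 2 - 1)) else BVar (R div 2 - 1))"
| "boolean_part n (FEq x y) = BConst True"
| "boolean_part n (FNot \<phi>) = BNot (boolean_part n \<phi>)"
| "boolean_part n (FAnd \<phi> \<psi>) = BAnd (boolean_part n \<phi>) (boolean_part n \<psi>)"
| "boolean_part n (FOr \<phi> \<psi>) = BOr (boolean_part n \<phi>) (boolean_part n \<psi>)"
| "boolean_part n (FEx x \<phi>) = boolean_part n \<phi>"
| "boolean_part n (FAll x \<phi>) = boolean_part n \<phi>"

lemma size_boolean_part: "bform_size (boolean_part n \<phi>) \<le> fo_size \<phi>"
  by (induction n \<phi> rule: boolean_part.induct) auto

lemma vars_boolean_part: "bform_vars (boolean_part n \<phi>) \<subseteq> {..<n}"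
  by (induction n \<phi> rule: boolean_part.induct) auto

text \<open>Presence of an atom means that its literal is false, so the even codes, those of
  positive literals, come out negated.\<close>

lemma Binary_reach_data:
  "Binary R 0 0 \<in> reach_data xs \<longleftrightarrow> R = 0 \<or> R \<noteq> 1 \<and> R < 2 * length xs + 2 \<and>
     (if even R then \<not> xs ! (R div 2 - 1) else xs ! (R div 2 - 1))" (is "_ \<longleftrightarrow> ?r")
proof
  assume "Binary R 0 0 \<in> reach_data xs"
  then obtain l where "R = label_pred l" "label_vars l \<subseteq> {..<length xs}" "\<not> label_val xs l"
    by (auto simp: reach_data_def)
  then show ?r by (cases l) (auto split: if_splits)
next
  assume r: ?r
  let ?l = "if R = 0 then LConst False else if even R then LPos (R div 2 - 1) else LNeg (R div 2 - 1)"
  have "label_pred ?l = R" using r by (cases "even R") (auto, presburger+)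
  moreover have "label_vars ?l \<subseteq> {..<length xs}" "\<not> label_val xs ?l"
    using r by (auto split: if_splits)
  ultimately show "Binary R 0 0 \<in> reach_data xs" unfolding reach_data_def by force
qed

lemma fo_sat_reach_data:
  "fo_sat {0} (reach_data xs) (\<lambda>_. 0) \<phi> \<longleftrightarrow> bform_val xs (boolean_part (length xs) \<phi>)"
proof -
  have upd: "(\<lambda>_. 0)(x := 0) = (\<lambda>_. 0 :: nat)" for x :: nat by auto
  show ?thesis
  proof (induction \<phi>)
    case (FAtom \<alpha>)
    then show ?case
      by (cases \<alpha>) (auto simp: Binary_reach_data simp flip: One_nat_def, auto simp: reach_data_def)
  qed (simp_all add: upd)
qed

theorem rewritings_imp_NL_poly_subset_NC1:
  assumes inf: "infinite (UNIV :: 'd set)"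
    and p: "\<forall>q T. wf_cq q \<longrightarrow> ontology T \<longrightarrow> of_depth T 1 \<longrightarrow>
      (\<exists>q'. fo_rewriting TYPE('d) q T q' \<and> fo_size q' \<le> poly p (cq_size q + ontology_size T))"
  shows "NL_poly \<subseteq> NC1"
proof
  fix f assume "f \<in> NL_poly"
  then obtain r :: "nat poly" where r: "\<forall>n. \<exists>B. wf_nbp n B \<and> nbp_size B \<le> poly r n \<and>
     (\<forall>xs. length xs = n \<longrightarrow> nbp_accepts B xs = f xs)"
    unfolding NL_poly_def by blast
  \<comment> \<open>The query has two atoms per arc and two more, the ontology has size
    \<open>4 * n + 6\<close>; the final summand pays for the negation that turns non-reachability
    into acceptance.\<close>
  let ?p = "pcompose p (2 * r + [:8, 4:]) + 1"
  have "\<exists>\<phi>. bform_vars \<phi> \<subseteq> {..<n} \<and> bform_size \<phi> \<le> poly ?p n \<and>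
     (\<forall>xs. length xs = n \<longrightarrow> bform_val xs \<phi> = f xs)" for n
  proof -
    obtain B where wf: "wf_nbp n B" and sz: "nbp_size B \<le> poly r n"
      and B: "\<forall>xs. length xs = n \<longrightarrow> nbp_accepts B xs = f xs"
      using r by blast
    \<comment> \<open>Finitely many vertices and labels leave finitely many arcs; otherwise the
      \<open>card\<close> in \<open>nbp_size\<close> would say nothing about them.\<close>
    have "arcs B \<subseteq> vertices B \<times> (LConst ` UNIV \<union> LPos ` {..<n} \<union> LNeg ` {..<n}) \<times> vertices B"
    proof
      fix e assume e: "e \<in> arcs B"
      obtain u l v where "e = (u, l, v)" by (cases e)
      then show "e \<in> vertices B \<times> (LConst ` UNIV \<union> LPos ` {..<n} \<union> LNeg ` {..<n}) \<times> vertices B"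
        using e wf unfolding wf_nbp_def by (cases l) auto
    qed
    then have "finite (arcs B)"
      by (rule finite_subset) (use wf in \<open>auto simp: wf_nbp_def\<close>)
    then obtain es where es: "set es = arcs B" "distinct es"
      using finite_distinct_list by blast
    have labels: "\<forall>(u, l, v)\<in>set es. label_vars l \<subseteq> {..<n}"
      using wf es unfolding wf_nbp_def by fast
    let ?q = "reach_query es (source B) (sink B)"
    have wfq: "wf_cq ?q" by (simp add: wf_cq_def reach_query_def)
    obtain q' where q': "fo_rewriting TYPE('d) ?q {reach_tgd n} q'"
      and q'_size: "fo_size q' \<le> poly p (cq_size ?q + ontology_size {reach_tgd n})"
      using p wfq ontology_reach of_depth_reach by blast
    have "length es \<le> poly r n"
      using sz es by (simp add: nbp_size_def flip: distinct_card)
    then have "cq_size ?q + ontology_size {reach_tgd n} \<le> poly (2 * r + [:8, 4:]) n"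
      by (simp add: size_reach_query size_reach_ontology)
    then have "fo_size q' \<le> poly p (poly (2 * r + [:8, 4:]) n)"
      using q'_size poly_nat_mono order_trans by blast
    then have "bform_size (BNot (boolean_part n q')) \<le> poly ?p n"
      using size_boolean_part[of n q'] by (simp add: poly_pcompose)
    moreover have "bform_val xs (BNot (boolean_part n q')) = f xs" if n: "length xs = n" for xs
    proof -
      have "fo_sat (ind (reach_data xs)) (reach_data xs) (\<lambda>_. 0) q' \<longleftrightarrow>
          entails_cq TYPE('d) {reach_tgd n} (reach_data xs) ?q []"
        using q' complete_reach_data[OF inf, of xs] finite_reach_data[of xs] n
        unfolding fo_rewriting_def by (auto simp: reach_query_def)
      also have "\<dots> \<longleftrightarrow> \<not> nbp_accepts B xs"
        using entails_reach_query[OF inf, of es xs "source B" "sink B"] labels n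
        by (simp add: nbp_accepts_def es)
      finally show ?thesis using B n by (simp add: ind_reach_data fo_sat_reach_data)
    qed
    ultimately show ?thesis using vars_boolean_part by (intro exI[of _ "BNot (boolean_part n q')"]) auto
  qed
  then show "f \<in> NC1" unfolding NC1_def by blast
qed

section \<open>Satisfiability of 2-CNFs\<close>

text \<open>\<open>E\<close> is the implication graph and \<open>S\<close> a set of true literals.
  Without a contradictory cycle, a maximal closed and consistent set decides every literal: of an
  undecided pair, one literal does not imply its negation, and its consequences can be
  added.\<close>

lemma two_sat:
  fixes E :: "'l rel"
  assumes L: "finite L" and neg_L: "\<And>x. x \<in> L \<Longrightarrow> neg x \<in> L"
    and neg_neg: "\<And>x. x \<in> L \<Longrightarrow> neg (neg x) = x"
    and E: "E \<subseteq> L \<times> L" and skew: "\<And>x y. (x, y) \<in> E \<Longrightarrow> (neg y, neg x) \<in> E"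
  shows "(\<exists>S. (\<forall>x\<in>L. x \<in> S \<longleftrightarrow> neg x \<notin> S) \<and> E `` S \<subseteq> S) \<longleftrightarrow>
    \<not> (\<exists>x\<in>L. (x, neg x) \<in> E\<^sup>* \<and> (neg x, x) \<in> E\<^sup>*)" (is "?sat \<longleftrightarrow> \<not> ?cycle")
proof
  have closed: "(x, y) \<in> E\<^sup>* \<Longrightarrow> E `` S \<subseteq> S \<Longrightarrow> x \<in> S \<Longrightarrow> y \<in> S" for x y S
    by (induction rule: rtrancl_induct) auto
  {
    assume ?sat
    then show "\<not> ?cycle" using closed by blast
  next
    assume no_cycle: "\<not> ?cycle"
    have skew_star: "(neg y, neg x) \<in> E\<^sup>*" if "(x, y) \<in> E\<^sup>*" for x y
      using that by (induction rule: rtrancl_induct) (auto intro: converse_rtrancl_into_rtrancl skew)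
    have L_star: "y \<in> L" if "(x, y) \<in> E\<^sup>*" "x \<in> L" for x y
      using that E by (induction rule: rtrancl_induct) auto
    define ok where "ok S \<longleftrightarrow> S \<subseteq> L \<and> E `` S \<subseteq> S \<and> (\<forall>x\<in>S. neg x \<notin> S)" for S
    have "finite (Collect ok)" using L by (rule_tac finite_subset[of _ "Pow L"]) (auto simp: ok_def)
    moreover have "ok {}" by (simp add: ok_def)
    ultimately obtain S where S: "ok S" and max: "\<And>S'. ok S' \<Longrightarrow> S \<subseteq> S' \<Longrightarrow> S = S'"
      using finite_has_maximal[of "Collect ok"] by auto
    have "x \<in> S \<or> neg x \<in> S" if x: "x \<in> L" for x
    proof (rule ccontr)
      assume notin: "\<not> (x \<in> S \<or> neg x \<in> S)"
      obtain z where z: "z \<in> L" "z \<notin> S" "neg z \<notin> S" "(z, neg z) \<notin> E\<^sup>*"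
      proof (cases "(x, neg x) \<in> E\<^sup>*")
        case True
        then have "(neg x, neg (neg x)) \<notin> E\<^sup>*" using no_cycle x neg_neg by auto
        then show ?thesis using that[of "neg x"] x notin neg_neg neg_L by auto
      next
        case False
        then show ?thesis using that[of x] x notin by auto
      qed
      let ?R = "E\<^sup>* `` {z}"
      \<comment> \<open>By contraposition \<open>neg y\<close> leads to \<open>neg z\<close>. So
        \<open>neg y\<close> in \<open>S\<close> would put \<open>neg z\<close> into
        \<open>S\<close>, and \<open>neg y\<close> reached from \<open>z\<close> would let
        \<open>z\<close> imply \<open>neg z\<close>.\<close>
      have apart: False if "y \<in> ?R" "neg y \<in> S \<union> ?R" for y
      proof -
        have y: "y \<in> L" using that z L_star by auto
        have "(neg y, neg z) \<in> E\<^sup>*" using that skew_star by auto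
        then show False using that(2) z closed[of "neg y" "neg z" S] S
          by (auto simp: ok_def intro: rtrancl_trans)
      qed
      have "ok (S \<union> ?R)"
      proof -
        have "neg y \<notin> S \<union> ?R" if "y \<in> S \<union> ?R" for y
        proof
          assume n: "neg y \<in> S \<union> ?R"
          have y: "y \<in> L" using that S z L_star by (auto simp: ok_def)
          from n that S consider "y \<in> ?R" | "y \<in> S" "neg y \<in> ?R" by (auto simp: ok_def)
          then show False using apart[of y] apart[of "neg y"] n neg_neg[OF y] by cases auto
        qed
        moreover have "S \<union> ?R \<subseteq> L" using S z L_star by (auto simp: ok_def)
        moreover have "E `` (S \<union> ?R) \<subseteq> S \<union> ?R" using S by (auto simp: ok_def intro: rtrancl_into_rtrancl)
        ultimately show ?thesis unfolding ok_def by blast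
      qed
      then have "S = S \<union> ?R" using max by blast
      then show False using z by blast
    qed
    then show ?sat using S neg_neg unfolding ok_def by (intro exI[of _ S]) blast
  }
qed

section \<open>Formulas for reachability\<close>

text \<open>A closed formula serves as the constant; being universal, it is true even over the empty
  domain of an empty data instance.\<close>

abbreviation FTrue :: fo where "FTrue \<equiv> FAll 0 (FEq 0 0)"
abbreviation FFalse :: fo where "FFalse \<equiv> FNot FTrue"

definition FConj :: "fo list \<Rightarrow> fo" where "FConj \<phi>s = foldr FAnd \<phi>s FTrue"
definition FDisj :: "fo list \<Rightarrow> fo" where "FDisj \<phi>s = foldr FOr \<phi>s FFalse"
definition FExs :: "nat list \<Rightarrow> fo \<Rightarrow> fo" where "FExs xs \<phi> = foldr FEx xs \<phi>"

lemma fo_sat_FConj: "fo_sat D I \<nu> (FConj \<phi>s) \<longleftrightarrow> (\<forall>\<phi>\<in>set \<phi>s. fo_sat D I \<nu> \<phi>)"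
  unfolding FConj_def by (induction \<phi>s) auto

lemma fo_sat_FDisj: "fo_sat D I \<nu> (FDisj \<phi>s) \<longleftrightarrow> (\<exists>\<phi>\<in>set \<phi>s. fo_sat D I \<nu> \<phi>)"
  unfolding FDisj_def by (induction \<phi>s) auto

lemma fo_sat_FExs: "fo_sat D I \<nu> (FExs xs \<phi>) \<longleftrightarrow>
    (\<exists>\<nu>'. (\<forall>x. x \<notin> set xs \<longrightarrow> \<nu>' x = \<nu> x) \<and> \<nu>' ` set xs \<subseteq> D \<and> fo_sat D I \<nu>' \<phi>)"
  unfolding FExs_def
proof (induction xs arbitrary: \<nu>)
  case Nil
  have "\<nu>' = \<nu>" if "\<forall>x. \<nu>' x = \<nu> x" for \<nu>' using that by auto
  then show ?case by auto
next
  case (Cons x xs)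
  show ?case
  proof
    assume "fo_sat D I \<nu> (foldr FEx (x # xs) \<phi>)"
    then obtain d \<nu>' where "d \<in> D" "\<forall>y. y \<notin> set xs \<longrightarrow> \<nu>' y = (\<nu>(x := d)) y" "\<nu>' ` set xs \<subseteq> D"
      "fo_sat D I \<nu>' \<phi>" using Cons by auto
    then show "\<exists>\<nu>'. (\<forall>y. y \<notin> set (x # xs) \<longrightarrow> \<nu>' y = \<nu> y) \<and> \<nu>' ` set (x # xs) \<subseteq> D \<and> fo_sat D I \<nu>' \<phi>"
      by (intro exI[of _ \<nu>']) (cases "x \<in> set xs"; auto)
  next
    assume "\<exists>\<nu>'. (\<forall>y. y \<notin> set (x # xs) \<longrightarrow> \<nu>' y = \<nu> y) \<and> \<nu>' ` set (x # xs) \<subseteq> D \<and> fo_sat D I \<nu>' \<phi>"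
    then obtain \<nu>' where \<nu>': "\<forall>y. y \<notin> set (x # xs) \<longrightarrow> \<nu>' y = \<nu> y" "\<nu>' ` set (x # xs) \<subseteq> D"
      "fo_sat D I \<nu>' \<phi>" by blast
    then have "fo_sat D I (\<nu>(x := \<nu>' x)) (foldr FEx xs \<phi>)"
      unfolding Cons by (intro exI[of _ \<nu>']) auto
    then show "fo_sat D I \<nu> (foldr FEx (x # xs) \<phi>)" using \<nu>'(2) by auto
  qed
qed

lemma fo_free_FConj: "fo_free (FConj \<phi>s) = (\<Union>\<phi>\<in>set \<phi>s. fo_free \<phi>)"
  unfolding FConj_def by (induction \<phi>s) auto

lemma fo_free_FDisj: "fo_free (FDisj \<phi>s) = (\<Union>\<phi>\<in>set \<phi>s. fo_free \<phi>)"
  unfolding FDisj_def by (induction \<phi>s) auto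

lemma fo_free_FExs: "fo_free (FExs xs \<phi>) = fo_free \<phi> - set xs"
  unfolding FExs_def by (induction xs) auto

lemma fo_size_FConj: "\<forall>\<phi>\<in>set \<phi>s. fo_size \<phi> \<le> k \<Longrightarrow> fo_size (FConj \<phi>s) \<le> (k + 1) * length \<phi>s + 5"
  unfolding FConj_def by (induction \<phi>s) auto

lemma fo_size_FDisj: "\<forall>\<phi>\<in>set \<phi>s. fo_size \<phi> \<le> k \<Longrightarrow> fo_size (FDisj \<phi>s) \<le> (k + 1) * length \<phi>s + 6"
  unfolding FDisj_def by (induction \<phi>s) auto

lemma fo_size_FExs: "fo_size (FExs xs \<phi>) = 2 * length xs + fo_size \<phi>"
  unfolding FExs_def by (induction xs) auto

section \<open>Substitution of first-order formulas into Boolean formulas\<close>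

fun bform_subst :: "(nat \<Rightarrow> fo) \<Rightarrow> bform \<Rightarrow> fo" where
  "bform_subst \<sigma> (BConst b) = (if b then FTrue else FFalse)"
| "bform_subst \<sigma> (BVar i) = \<sigma> i"
| "bform_subst \<sigma> (BNot \<phi>) = FNot (bform_subst \<sigma> \<phi>)"
| "bform_subst \<sigma> (BAnd \<phi> \<psi>) = FAnd (bform_subst \<sigma> \<phi>) (bform_subst \<sigma> \<psi>)"
| "bform_subst \<sigma> (BOr \<phi> \<psi>) = FOr (bform_subst \<sigma> \<phi>) (bform_subst \<sigma> \<psi>)"

lemma fo_sat_bform_subst:
  "(\<And>i. i \<in> bform_vars \<phi> \<Longrightarrow> fo_sat D I \<nu> (\<sigma> i) = xs ! i) \<Longrightarrow>
    fo_sat D I \<nu> (bform_subst \<sigma> \<phi>) = bform_val xs \<phi>"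
  by (induction \<phi>) auto

lemma fo_free_bform_subst: "fo_free (bform_subst \<sigma> \<phi>) \<subseteq> (\<Union>i. fo_free (\<sigma> i))"
  by (induction \<phi>) auto

lemma fo_size_bform_subst:
  "(\<And>i. fo_size (\<sigma> i) \<le> k) \<Longrightarrow> fo_size (bform_subst \<sigma> \<phi>) \<le> (k + 6) * bform_size \<phi>"
proof (induction \<phi>)
  case (BVar i)
  show ?case using BVar[of i] by (simp add: trans_le_add1)
qed (auto simp: algebra_simps)

text \<open>A string is read as an adjacency matrix whose entries are numbered by
  \<open>prod_decode\<close>; thus a single family of functions covers reachability in all finite
  graphs.\<close>

definition input_graph :: "bool list \<Rightarrow> nat rel" where
  "input_graph xs = {prod_decode k | k. k < length xs \<and> xs ! k}"

lemma reachability_NL_poly: "(\<lambda>xs. (0, 1) \<in> (input_graph xs)\<^sup>*) \<in> NL_poly"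
proof -
  have "\<exists>B. wf_nbp n B \<and> nbp_size B \<le> poly [:2, 2:] n \<and>
     (\<forall>xs. length xs = n \<longrightarrow> nbp_accepts B xs = ((0, 1) \<in> (input_graph xs)\<^sup>*))" for n
  proof -
    let ?arc = "\<lambda>k. (fst (prod_decode k), LPos k, snd (prod_decode k))"
    \<comment> \<open>Both components of \<open>prod_decode k\<close> are at most \<open>k\<close>,
      and \<open>n + 2\<close> ensures that the source 0 and the sink 1 are vertices even if
      \<open>n = 0\<close>.\<close>
    let ?B = "NBP {..<n + 2} (?arc ` {..<n}) 0 1"
    have less: "fst (prod_decode k) \<le> k" "snd (prod_decode k) \<le> k" for k
      using le_prod_encode_1[of "fst (prod_decode k)" "snd (prod_decode k)"]
        le_prod_encode_2[of "snd (prod_decode k)" "fst (prod_decode k)"] by simp_all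
    have "wf_nbp n ?B"
      by (auto simp: wf_nbp_def intro: le_less_trans[OF less(1)] le_less_trans[OF less(2)])
    moreover have "nbp_size ?B \<le> poly [:2, 2:] n"
      using card_image_le[OF finite_lessThan, of ?arc n] by (simp add: nbp_size_def)
    moreover have "nbp_accepts ?B xs = ((0, 1) \<in> (input_graph xs)\<^sup>*)" if "length xs = n" for xs
    proof -
      have "{(u, v). \<exists>l. (u, l, v) \<in> arcs ?B \<and> label_val xs l} = input_graph xs"
      proof -
        have "(\<exists>l. (u, l, v) \<in> arcs ?B \<and> label_val xs l) \<longleftrightarrow> (\<exists>k<n. prod_decode k = (u, v) \<and> xs ! k)" for u v
          by (simp add: image_iff prod_eq_iff) fastforce
        then show ?thesis using that by (auto simp: input_graph_def) metis
      qed
      then show ?thesis unfolding nbp_accepts_def by simp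
    qed
    ultimately show ?thesis by blast
  qed
  then show ?thesis unfolding NL_poly_def by blast
qed

text \<open>Keeps the length of the adjacency string quadratic in the number of vertices.\<close>

lemma prod_encode_less: "i < N \<Longrightarrow> j < N \<Longrightarrow> prod_encode (i, j) < 4 * N * N"
proof -
  assume ij: "i < N" "j < N"
  have tri: "triangle k \<le> k * k" for k by (induction k) auto
  have "prod_encode (i, j) \<le> (i + j) * (i + j) + i" using tri by (simp add: prod_encode_def)
  also have "\<dots> < (i + j + 1) * (i + j + 1)" by (simp add: algebra_simps)
  also have "\<dots> \<le> (2 * N) * (2 * N)" using ij by (intro mult_mono) auto
  finally show ?thesis by (simp add: algebra_simps)
qed

text \<open>The formulas \<open>\<epsilon> i j\<close> replace the bits of the adjacency string. In
  \<open>k + 12\<close>, one 6 allows for truth constants in place of edges, the other is the loss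
  in \<open>fo_size_bform_subst\<close>; both stem from the size of \<open>FFalse\<close>.\<close>

lemma fo_reachability:
  assumes "NL_poly \<subseteq> NC1"
  shows "\<exists>p :: nat poly. \<forall>N (\<epsilon> :: nat \<Rightarrow> nat \<Rightarrow> fo) k s t. (\<forall>i<N. \<forall>j<N. fo_size (\<epsilon> i j) \<le> k) \<longrightarrow> s < N \<longrightarrow> t < N \<longrightarrow>
    (\<exists>\<phi>. fo_free \<phi> \<subseteq> (\<Union>i<N. \<Union>j<N. fo_free (\<epsilon> i j)) \<and> fo_size \<phi> \<le> (k + 12) * poly p N \<and>
      (\<forall>D (I :: nat atom set) \<nu>. fo_sat D I \<nu> \<phi> \<longleftrightarrow>
        (s, t) \<in> {(i, j). i < N \<and> j < N \<and> fo_sat D I \<nu> (\<epsilon> i j)}\<^sup>*))"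
proof -
  have "(\<lambda>xs. (0, 1) \<in> (input_graph xs)\<^sup>*) \<in> NC1"
    using reachability_NL_poly assms by blast
  then obtain p :: "nat poly" where p: "\<forall>n. \<exists>\<phi>. bform_vars \<phi> \<subseteq> {..<n} \<and> bform_size \<phi> \<le> poly p n \<and>
     (\<forall>xs. length xs = n \<longrightarrow> bform_val xs \<phi> = ((0, 1) \<in> (input_graph xs)\<^sup>*))"
    unfolding NC1_def by blast
  have "\<exists>\<phi>. fo_free \<phi> \<subseteq> (\<Union>i<N. \<Union>j<N. fo_free (\<epsilon> i j)) \<and>
      fo_size \<phi> \<le> (k + 12) * poly (pcompose p [:16, 16, 4:]) N \<and>
      (\<forall>D (I :: nat atom set) \<nu>. fo_sat D I \<nu> \<phi> \<longleftrightarrow>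
        (s, t) \<in> {(i, j). i < N \<and> j < N \<and> fo_sat D I \<nu> (\<epsilon> i j)}\<^sup>*)"
    if k: "\<forall>i<N. \<forall>j<N. fo_size (\<epsilon> i j) \<le> k" and st: "s < N" "t < N" for N \<epsilon> k s t
  proof -
    let ?n = "4 * (N + 2) * (N + 2)"
    obtain \<phi> where vars: "bform_vars \<phi> \<subseteq> {..<?n}" and sz: "bform_size \<phi> \<le> poly p ?n"
      and val: "\<forall>xs. length xs = ?n \<longrightarrow> bform_val xs \<phi> = ((0, 1) \<in> (input_graph xs)\<^sup>*)"
      using p by blast
    \<comment> \<open>Vertex \<open>i\<close> becomes \<open>i + 2\<close>; the new source \<open>0\<close> and sink \<open>1\<close> are attached to \<open>s\<close> and \<open>t\<close>.\<close>
    define \<eta> where "\<eta> i j = (if i = 0 then if j = s + 2 then FTrue else FFalse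
      else if j = 1 then if i = t + 2 then FTrue else FFalse
      else if 2 \<le> i \<and> 2 \<le> j \<and> i < N + 2 \<and> j < N + 2 then \<epsilon> (i - 2) (j - 2) else FFalse)" for i j
    define \<sigma> where "\<sigma> m = \<eta> (fst (prod_decode m)) (snd (prod_decode m))" for m
    have \<sigma>_cases: "\<sigma> m \<in> {FTrue, FFalse} \<or> (\<exists>i<N. \<exists>j<N. \<sigma> m = \<epsilon> i j)" for m
    proof -
      have "\<eta> i j \<in> {FTrue, FFalse} \<or> (\<exists>i'<N. \<exists>j'<N. \<eta> i j = \<epsilon> i' j')" for i j
      proof (cases "\<eta> i j \<in> {FTrue, FFalse}")
        case False
        then have "\<eta> i j = \<epsilon> (i - 2) (j - 2) \<and> i - 2 < N \<and> j - 2 < N"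
          by (auto simp: \<eta>_def split: if_splits)
        then show ?thesis by blast
      qed simp
      then show ?thesis unfolding \<sigma>_def .
    qed
    have "fo_size (\<sigma> m) \<le> k + 6" for m
      using \<sigma>_cases[of m] k by (auto intro: trans_le_add1)
    then have "fo_size (bform_subst \<sigma> \<phi>) \<le> (k + 6 + 6) * bform_size \<phi>"
      by (rule fo_size_bform_subst)
    also have "\<dots> \<le> (k + 12) * poly p ?n" using sz by (simp add: mult_le_mono)
    also have "?n = poly [:16, 16, 4:] N" by (simp add: algebra_simps)
    also have "poly p (poly [:16, 16, 4:] N) = poly (pcompose p [:16, 16, 4:]) N"
      by (simp only: poly_pcompose)
    finally have size: "fo_size (bform_subst \<sigma> \<phi>) \<le> (k + 12) * poly (pcompose p [:16, 16, 4:]) N" .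
    have "fo_free (\<sigma> m) \<subseteq> (\<Union>i<N. \<Union>j<N. fo_free (\<epsilon> i j))" for m
      using \<sigma>_cases[of m] by fastforce
    then have free: "fo_free (bform_subst \<sigma> \<phi>) \<subseteq> (\<Union>i<N. \<Union>j<N. fo_free (\<epsilon> i j))"
      by (rule order_trans[OF fo_free_bform_subst UN_least])
    have sat: "fo_sat D I \<nu> (bform_subst \<sigma> \<phi>) \<longleftrightarrow>
        (s, t) \<in> {(i, j). i < N \<and> j < N \<and> fo_sat D I \<nu> (\<epsilon> i j)}\<^sup>*" (is "_ \<longleftrightarrow> _ \<in> ?E\<^sup>*")
      for D and I :: "nat atom set" and \<nu>
    proof -
      define xs where "xs = map (\<lambda>m. fo_sat D I \<nu> (\<sigma> m)) [0..<?n]"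
      have "fo_sat D I \<nu> (bform_subst \<sigma> \<phi>) = bform_val xs \<phi>"
        by (rule fo_sat_bform_subst) (use vars in \<open>auto simp: xs_def simp del: upt_Suc\<close>)
      also have "\<dots> \<longleftrightarrow> (0, 1) \<in> (input_graph xs)\<^sup>*"
        using val by (simp add: xs_def)
      also have "input_graph xs = {(i, j). prod_encode (i, j) < ?n \<and> fo_sat D I \<nu> (\<eta> i j)}"
      proof -
        have "(i, j) \<in> input_graph xs \<longleftrightarrow> prod_encode (i, j) < ?n \<and> fo_sat D I \<nu> (\<eta> i j)" for i j
        proof -
          have "(i, j) \<in> input_graph xs \<longleftrightarrow> prod_encode (i, j) < length xs \<and> xs ! prod_encode (i, j)"
          proof -
            have "(i, j) = prod_decode m \<longleftrightarrow> m = prod_encode (i, j)" for m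
              by (metis prod_decode_inverse prod_encode_inverse)
            then show ?thesis by (auto simp: input_graph_def)
          qed
          then show ?thesis by (auto simp: xs_def \<sigma>_def simp del: upt_Suc)
        qed
        then show ?thesis by auto
      qed
      also have "\<dots> = {(0, s + 2), (t + 2, 1)} \<union> {(i + 2, j + 2) | i j. (i, j) \<in> ?E}" (is "_ = ?G")
      proof -
        have "fo_sat D I \<nu> (\<eta> i j) \<longleftrightarrow> (i, j) \<in> ?G" for i j
        proof -
          have "(i, j) \<in> ?G \<longleftrightarrow> i = 0 \<and> j = s + 2 \<or> i = t + 2 \<and> j = 1 \<or>
              (2 \<le> i \<and> 2 \<le> j \<and> (i - 2, j - 2) \<in> ?E)"
          proof (cases "2 \<le> i \<and> 2 \<le> j")
            case True
            then obtain i' j' where "i = i' + 2" "j = j' + 2" by (metis le_add_diff_inverse2)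
            then show ?thesis by simp
          qed auto
          then show ?thesis by (auto simp: \<eta>_def)
        qed
        moreover have "prod_encode (i, j) < ?n" if "(i, j) \<in> ?G" for i j
          using that st by (intro prod_encode_less) auto
        ultimately show ?thesis by auto
      qed
      also have "(0, 1) \<in> ?G\<^sup>* \<longleftrightarrow> (s, t) \<in> ?E\<^sup>*"
      proof
        have from0: "v = 0 \<or> (\<exists>i. v = i + 2 \<and> (s, i) \<in> ?E\<^sup>*) \<or> v = 1 \<and> (s, t) \<in> ?E\<^sup>*"
          if "(0, v) \<in> ?G\<^sup>*" for v
          using that
          by (induction rule: rtrancl_induct) (auto intro: rtrancl_into_rtrancl)
        assume "(0, 1) \<in> ?G\<^sup>*"
        then show "(s, t) \<in> ?E\<^sup>*" using from0[of 1] by auto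
      next
        have lift: "(s + 2, v + 2) \<in> ?G\<^sup>*" if "(s, v) \<in> ?E\<^sup>*" for v
          using that
        proof (induction rule: rtrancl_induct)
          case (step u v)
          then have "(u + 2, v + 2) \<in> ?G" by blast
          then show ?case using step.IH by (rule rtrancl_into_rtrancl[rotated])
        qed simp
        have "(0, s + 2) \<in> ?G" "(t + 2, 1) \<in> ?G" by simp_all
        moreover assume "(s, t) \<in> ?E\<^sup>*"
        ultimately show "(0, 1) \<in> ?G\<^sup>*"
          using lift[of t] by (meson converse_rtrancl_into_rtrancl rtrancl.rtrancl_into_rtrancl)
      qed
      finally show ?thesis .
    qed
    show ?thesis using size free sat by blast
  qed
  then show ?thesis by blast
qed

section \<open>Canonical models of single atoms\<close>

text \<open>Every data atom \<open>Binary P a b\<close> is an instance of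
  \<open>Binary P 0 1\<close>. A loop also has its own form, because in the canonical model of
  \<open>Binary P 0 1\<close> the two arguments are distinct and a body \<open>P(x, x)\<close> would
  not match.\<close>

fun gen_forms :: "nat atom \<Rightarrow> nat atom list" where
  "gen_forms (Unary P x) = [Unary P 0]"
| "gen_forms (Binary P x y) = [Binary P 0 0, Binary P 0 1]"

definition gens :: "tgd set \<Rightarrow> nat atom set" where
  "gens T = (\<Union>\<tau>\<in>T. set (concat (map gen_forms (body \<tau> # head \<tau>))))"

lemma gens_subset_generators: "gens T \<subseteq> generators T"
proof
  fix \<rho> assume "\<rho> \<in> gens T"
  then obtain \<tau> \<psi> where "\<tau> \<in> T" "\<psi> \<in> insert (body \<tau>) (set (head \<tau>))" "\<rho> \<in> set (gen_forms \<psi>)"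
    by (auto simp: gens_def)
  then show "\<rho> \<in> generators T"
    by (cases \<psi>) (auto simp: generators_def unary_preds_def binary_preds_def)
qed

lemma gens_list:
  assumes "finite T"
  obtains gl where "set gl = gens T" "length gl \<le> 2 * ontology_size T"
proof -
  have len: "length (concat (map gen_forms \<psi>s)) \<le> 2 * length \<psi>s" for \<psi>s
  proof (induction \<psi>s)
    case (Cons \<psi> \<psi>s)
    then show ?case by (cases \<psi>) auto
  qed simp
  have "card (gens T) \<le> (\<Sum>\<tau>\<in>T. card (set (concat (map gen_forms (body \<tau> # head \<tau>)))))"
    unfolding gens_def using assms by (rule card_UN_le)
  also have "\<dots> \<le> (\<Sum>\<tau>\<in>T. 2 * (1 + length (head \<tau>)))"
    by (intro sum_mono order_trans[OF card_length order_trans[OF len]]) simp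
  finally have "card (gens T) \<le> 2 * ontology_size T" by (simp add: ontology_size_def sum_distrib_left)
  moreover obtain gl where "set gl = gens T" "distinct gl"
    using finite_distinct_list[of "gens T"] assms by (auto simp: gens_def)
  ultimately show ?thesis using that[of gl] distinct_card[of gl] by auto
qed

lemma map_atom_eq_iff: "map_atom f \<alpha> = map_atom g \<alpha> \<longleftrightarrow> (\<forall>v\<in>set_atom \<alpha>. f v = g v)"
  by (cases \<alpha>) auto

text \<open>A null records the body instance that created it, so a homomorphism can be defined by
  recursion on elements instead of chase stages; \<open>W\<close> supplies the witness for the image
  of that instance.\<close>

primrec elem_hom :: "(tgd \<Rightarrow> nat \<Rightarrow> 'd atom \<Rightarrow> 'd) \<Rightarrow> (nat \<Rightarrow> 'd) \<Rightarrow> elem \<Rightarrow> 'd" where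
  "elem_hom W c (Ind i) = c i"
| "elem_hom W c (Null \<tau> y \<beta>) = W \<tau> y (map_atom (elem_hom W c) \<beta>)"

section \<open>Canonical models for ontologies of depth at most 1\<close>

locale shallow =
  fixes T :: "tgd set" and F :: nat
  assumes onto: "ontology T" and depth: "\<not> has_chain T 2" and fresh: "F \<notin> unary_preds T"
begin

text \<open>The fresh atom is removed so that the rest maps into every model of
  \<open>\<rho>\<close>.\<close>

definition can :: "nat atom \<Rightarrow> elem atom set" where
  "can \<rho> = canonical_model T F \<rho> - {Unary F (Ind 0)}"

lemma body_not_fresh: "\<tau> \<in> T \<Longrightarrow> map_atom f (body \<tau>) \<noteq> Unary F x"
  using fresh by (cases "body \<tau>") (force simp: unary_preds_def)+

lemma head_not_fresh: "\<tau> \<in> T \<Longrightarrow> \<psi> \<in> set (head \<tau>) \<Longrightarrow> map_atom f \<psi> \<noteq> Unary F x"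
  using fresh by (cases \<psi>) (force simp: unary_preds_def)+

lemma can_sat_tgd:
  assumes "\<tau> \<in> T"
  shows "sat_tgd UNIV (can \<rho>) \<tau>"
proof -
  have "sat_tgd UNIV (canonical_model T F \<rho>) \<tau>"
    unfolding canonical_model_def using assms by (intro chase_sat_tgd) simp
  then show ?thesis
    unfolding sat_tgd_def can_def using head_not_fresh[OF assms] by (metis DiffD1 DiffI singletonD)
qed

lemma can_root:
  assumes "\<rho> \<in> generators T"
  shows "map_atom (at_pair (Ind 0) (root_null F \<rho>)) \<rho> \<in> can \<rho>"
  using canonical_model_root[OF assms fresh] generator_not_fresh[OF assms fresh]
  by (cases \<rho>) (auto simp: can_def)

text \<open>The variables 0 and 1 of \<open>\<rho>\<close> double as individual constants, so that
  \<open>{\<rho>}\<close> is a data instance. Each null goes to a witness of its tgd in the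
  model.\<close>

lemma can_universal:
  assumes \<rho>: "\<rho> \<in> generators T" and M: "is_model T {\<rho>} D c I"
  obtains h where "range h \<subseteq> D" "h (Ind 0) = c 0" "h (root_null F \<rho>) = c 1"
    "\<And>\<alpha>. \<alpha> \<in> can \<rho> \<Longrightarrow> map_atom h \<alpha> \<in> I"
proof -
  let ?\<tau> = "Tgd (Unary F 0) [\<rho>]"
  define good where "good \<tau> \<beta> \<mu> \<longleftrightarrow> range \<mu> \<subseteq> D \<and> map_atom \<mu> (body \<tau>) = \<beta> \<and>
    (\<forall>\<psi>\<in>set (head \<tau>). map_atom \<mu> \<psi> \<in> I)" for \<tau> \<beta> \<mu>
  \<comment> \<open>The null of the fresh tgd goes to \<open>c 1\<close>. The default
    \<open>c 0\<close> only keeps the values of elements without a witness inside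
    \<open>D\<close>.\<close>
  define W where "W \<tau> y \<beta> = (if \<tau> = ?\<tau> then c y
    else if \<exists>\<mu>. good \<tau> \<beta> \<mu> then (SOME \<mu>. good \<tau> \<beta> \<mu>) y else c 0)" for \<tau> y \<beta>
  define h where "h = elem_hom W c"
  have c: "c i \<in> D" for i using M by (auto simp: is_model_def)
  have h_Null: "h (Null \<tau> y \<beta>) = W \<tau> y (map_atom h \<beta>)" for \<tau> y \<beta> by (simp add: h_def)
  have W: "W \<tau> y \<beta> \<in> D" for \<tau> y \<beta>
  proof (cases "\<tau> \<noteq> ?\<tau> \<and> (\<exists>\<mu>. good \<tau> \<beta> \<mu>)")
    case True
    then have "good \<tau> \<beta> (SOME \<mu>. good \<tau> \<beta> \<mu>)" using someI_ex[of "good \<tau> \<beta>"] by blast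
    moreover have "good \<tau> \<beta> \<mu> \<Longrightarrow> \<mu> y \<in> D" for \<mu> by (auto simp: good_def)
    ultimately show ?thesis using True by (simp add: W_def)
  qed (use c in \<open>auto simp: W_def\<close>)
  have "h x \<in> D" for x by (cases x) (auto simp: h_def c W)
  moreover have "h (Ind 0) = c 0" "h (root_null F \<rho>) = c 1"
    by (simp_all add: h_def root_null_def W_def)
  \<comment> \<open>The invariant also confines \<open>F\<close> to the individual, so that the
    fresh tgd is applied only there.\<close>
  moreover have "\<alpha> = Unary F (Ind 0) \<or> \<alpha> \<notin> range (Unary F) \<and> map_atom h \<alpha> \<in> I"
    if "\<alpha> \<in> canonical_model T F \<rho>" for \<alpha>
    using that unfolding canonical_model_def
  proof (induction rule: chase_induct)
    case (base \<alpha>)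
    then show ?case by simp
  next
    case (step \<tau> \<nu> \<psi>)
    show ?case
    proof (cases "\<tau> = ?\<tau>")
      case True
      then have \<nu>0: "\<nu> 0 = Ind 0" using step.IH by auto
      have "h (with_nulls ?\<tau> \<nu> v) = c v" for v
        by (cases "v = 0") (simp_all add: with_nulls_def \<nu>0 h_Null W_def, simp add: h_def)
      then have "map_atom h (map_atom (with_nulls ?\<tau> \<nu>) \<rho>) = map_atom c \<rho>"
        by (simp add: atom.map_comp comp_def)
      moreover have "map_atom c \<rho> \<in> I" using M by (simp add: is_model_def)
      moreover have "map_atom (with_nulls ?\<tau> \<nu>) \<rho> \<notin> range (Unary F)"
        using generator_not_fresh[OF \<rho> fresh] by (cases \<rho>) auto
      ultimately show ?thesis using True step.hyps(3) by simp
    next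
      case False
      then have \<tau>: "\<tau> \<in> T" using step.hyps(1) by simp
      let ?\<beta> = "map_atom h (map_atom \<nu> (body \<tau>))"
      have "?\<beta> \<in> I" using step.IH body_not_fresh[OF \<tau>, of \<nu>] by auto
      then have "map_atom (h \<circ> \<nu>) (body \<tau>) \<in> I" by (simp add: atom.map_comp)
      moreover have "range (h \<circ> \<nu>) \<subseteq> D" using \<open>\<And>x. h x \<in> D\<close> by auto
      moreover have "sat_tgd D I \<tau>" using M \<tau> by (simp add: is_model_def)
      ultimately obtain \<mu> where "range \<mu> \<subseteq> D" "\<forall>v\<in>set_atom (body \<tau>). \<mu> v = (h \<circ> \<nu>) v"
        "\<forall>\<psi>\<in>set (head \<tau>). map_atom \<mu> \<psi> \<in> I"
        unfolding sat_tgd_def by blast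
      then have "good \<tau> ?\<beta> \<mu>" by (simp add: good_def atom.map_comp map_atom_eq_iff)
      then have ex: "\<exists>\<mu>. good \<tau> ?\<beta> \<mu>" by blast
      define m where "m = (SOME \<mu>. good \<tau> ?\<beta> \<mu>)"
      have m: "good \<tau> ?\<beta> m" unfolding m_def using ex by (rule someI_ex)
      have "h (with_nulls \<tau> \<nu> v) = m v" for v
      proof (cases "v \<in> set_atom (body \<tau>)")
        case True
        then show ?thesis using m by (simp add: good_def with_nulls_def atom.map_comp map_atom_eq_iff)
      next
        case v: False
        have "W \<tau> v ?\<beta> = m v" using ex False by (simp add: W_def m_def)
        then show ?thesis using v by (simp add: with_nulls_def h_Null)
      qed
      then have "map_atom h (map_atom (with_nulls \<tau> \<nu>) \<psi>) = map_atom m \<psi>"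
        by (simp add: atom.map_comp comp_def)
      moreover have "map_atom (with_nulls \<tau> \<nu>) \<psi> \<notin> range (Unary F)"
        using head_not_fresh[OF \<tau> step.hyps(3)] by (metis rangeE)
      ultimately show ?thesis using m step.hyps(3) by (simp add: good_def)
    qed
  qed
  ultimately show ?thesis using that[of h] by (auto simp: can_def)
qed

text \<open>The singleton gives a null exactly one parent, as \<open>adj_child\<close> requires. The
  last clause excludes \<open>root_null\<close> when 1 does not occur in
  \<open>\<rho>\<close>.\<close>

definition null_like :: "elem \<Rightarrow> bool" where
  "null_like w \<longleftrightarrow> (\<exists>\<tau> y \<beta> u. w = Null \<tau> y \<beta> \<and> set_atom \<beta> = {u} \<and> (\<exists>\<psi>\<in>set (head \<tau>). y \<in> set_atom \<psi>))"

text \<open>With at most two variables per tgd, an existential variable leaves room for one body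
  variable only: its null is created at a single element, and no head atom joins two different new
  nulls.\<close>

lemma canonical_model_shape:
  assumes \<rho>: "\<rho> \<in> generators T" and "\<alpha> \<in> canonical_model T F \<rho>"
  shows "(\<forall>w\<in>set_atom \<alpha>. w = Ind 0 \<or> null_like w) \<and>
    (\<forall>R x y. \<alpha> = Binary R x y \<longrightarrow> x = y \<or> created_at x y \<or> created_at y x)"
  using assms(2) unfolding canonical_model_def
proof (induction rule: chase_induct)
  case (base \<alpha>)
  then show ?case by auto
next
  case (step \<tau> \<nu> \<psi>)
  have "finite (tgd_vars \<tau>)" by (simp add: tgd_vars_def)
  moreover have "card (tgd_vars \<tau>) \<le> 2"
  proof (cases "\<tau> \<in> T")
    case True
    then show ?thesis using onto by (simp add: ontology_def)
  next
    case False
    then have "tgd_vars \<tau> \<subseteq> {0, 1}"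
      using step.hyps(1) generator_vars[OF \<rho>] by (auto simp: tgd_vars_def)
    then show ?thesis using card_mono[of "{0, 1}" "tgd_vars \<tau>"] by simp
  qed
  ultimately have three: False if "{u, v, w} \<subseteq> tgd_vars \<tau>" "u \<noteq> v" "u \<noteq> w" "v \<noteq> w" for u v w
    using card_mono[of "tgd_vars \<tau>" "{u, v, w}"] that by simp
  have sub: "set_atom (body \<tau>) \<subseteq> tgd_vars \<tau>" "set_atom \<psi> \<subseteq> tgd_vars \<tau>"
    using step.hyps(3) by (auto simp: tgd_vars_def)
  obtain x where x: "x \<in> set_atom (body \<tau>)" by (cases "body \<tau>") auto
  have old: "with_nulls \<tau> \<nu> v = \<nu> v" if "v \<in> set_atom (body \<tau>)" for v
    using that by (simp add: with_nulls_def)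
  have new: "with_nulls \<tau> \<nu> v = Null \<tau> v (map_atom \<nu> (body \<tau>))" if "v \<notin> set_atom (body \<tau>)" for v
    using that by (simp add: with_nulls_def)
  have in_body: "\<nu> v \<in> set_atom (map_atom \<nu> (body \<tau>))" if "v \<in> set_atom (body \<tau>)" for v
    using that by (simp add: atom.set_map)
  have "with_nulls \<tau> \<nu> v = Ind 0 \<or> null_like (with_nulls \<tau> \<nu> v)" if v: "v \<in> set_atom \<psi>" for v
  proof (cases "v \<in> set_atom (body \<tau>)")
    case True
    then show ?thesis using step.IH in_body old by auto
  next
    case False
    then have "set_atom (body \<tau>) = {x}" using three[of x _ v] x sub v by blast
    then show ?thesis using new[OF False] v step.hyps(3) by (auto simp: null_like_def atom.set_map)
  qed
  moreover have "with_nulls \<tau> \<nu> u = with_nulls \<tau> \<nu> v \<or> created_at (with_nulls \<tau> \<nu> u) (with_nulls \<tau> \<nu> v) \<or>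
      created_at (with_nulls \<tau> \<nu> v) (with_nulls \<tau> \<nu> u)" if uv: "\<psi> = Binary R u v" for R u v
  proof (cases "u = v")
    case False
    have uv': "u \<in> tgd_vars \<tau>" "v \<in> tgd_vars \<tau>" using sub uv by auto
    show ?thesis
    proof (cases "u \<in> set_atom (body \<tau>)"; cases "v \<in> set_atom (body \<tau>)")
      assume "u \<in> set_atom (body \<tau>)" "v \<in> set_atom (body \<tau>)"
      then show ?thesis using step.IH old False by (cases "body \<tau>") auto
    next
      assume "u \<in> set_atom (body \<tau>)" "v \<notin> set_atom (body \<tau>)"
      then show ?thesis using old new in_body by (auto simp: created_at_def)
    next
      assume "u \<notin> set_atom (body \<tau>)" "v \<in> set_atom (body \<tau>)"
      then show ?thesis using old new in_body by (auto simp: created_at_def)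
    next
      assume "u \<notin> set_atom (body \<tau>)" "v \<notin> set_atom (body \<tau>)"
      then show ?thesis using three[of x u v] x sub uv' False by blast
    qed
  qed simp
  ultimately show ?case by (cases \<psi>) auto
qed

section \<open>Neighbours of nulls\<close>

definition adj :: "nat atom \<Rightarrow> elem \<Rightarrow> elem \<Rightarrow> bool" where
  "adj \<rho> w w' \<longleftrightarrow> (\<exists>R. Binary R w w' \<in> can \<rho> \<or> Binary R w' w \<in> can \<rho>)"

lemma can_elem:
  assumes "\<rho> \<in> generators T" "\<alpha> \<in> can \<rho>" "w \<in> set_atom \<alpha>"
  shows "w = Ind 0 \<or> null_like w"
  using canonical_model_shape[OF assms(1)] assms(2,3) unfolding can_def by blast

lemma root_null_occurs:
  assumes \<rho>: "\<rho> \<in> generators T" "\<alpha> \<in> can \<rho>" "root_null F \<rho> \<in> set_atom \<alpha>"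
  shows "1 \<in> set_atom \<rho>"
  using can_elem[OF assms] by (auto simp: root_null_def null_like_def)

lemma adj_elem:
  assumes "\<rho> \<in> generators T" "adj \<rho> w w'"
  shows "w = Ind 0 \<or> null_like w" "w' = Ind 0 \<or> null_like w'"
    "w = w' \<or> created_at w w' \<or> created_at w' w"
  using canonical_model_shape[OF assms(1)] assms(2) unfolding adj_def can_def by fastforce+

lemma adj_sym: "adj \<rho> w w' \<Longrightarrow> adj \<rho> w' w"
  by (auto simp: adj_def)

lemma no_chain:
  assumes \<rho>: "\<rho> \<in> generators T"
    and "adj \<rho> w0 w1" "w1 \<notin> range Ind" "created_at w0 w1 \<or> w1 = w0"
    and "adj \<rho> w1 w2" "w2 \<notin> range Ind" "created_at w1 w2 \<or> w2 = w1"
  shows False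
proof -
  define w where "w i = (if i = 0 then w0 else if i = 1 then w1 else w2)" for i :: nat
  have "chain_link (canonical_model T F \<rho>) (w i) (w (Suc i))" if "i < 2" for i
    using that assms(2-) unfolding chain_link_def adj_def can_def w_def
    by (cases "i = 0") auto
  then show False using depth \<rho> fresh unfolding has_chain_def by blast
qed

lemma adj_null_irrefl: "\<rho> \<in> generators T \<Longrightarrow> adj \<rho> w w \<Longrightarrow> w = Ind 0"
  using no_chain[of \<rho> w w w] adj_elem(1)[of \<rho> w w] by (auto simp: null_like_def)

text \<open>A null created at \<open>n\<close>, or a loop at \<open>n\<close>, would prolong the
  link from the individual to a chain of length 2. So \<open>n\<close> was created at
  \<open>w\<close>, and its only parent is the individual.\<close>

lemma adj_child:
  assumes \<rho>: "\<rho> \<in> generators T" and n: "adj \<rho> (Ind 0) n" "n \<noteq> Ind 0" and w: "adj \<rho> n w"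
  shows "w = Ind 0"
proof -
  have null: "null_like n" using adj_elem(2)[OF \<rho> n(1)] n(2) by blast
  then have "n \<notin> range Ind" by (auto simp: null_like_def)
  moreover have cr: "created_at (Ind 0) n" using adj_elem(3)[OF \<rho> n(1)] n(2) by (auto simp: created_at_def)
  ultimately have "\<not> created_at n w"
    using no_chain[OF \<rho> n(1) _ _ w] by (auto simp: created_at_def)
  moreover have "n \<noteq> w" using adj_null_irrefl[OF \<rho>] w n by blast
  ultimately have "created_at w n" using adj_elem(3)[OF \<rho> w] by blast
  then show ?thesis using null cr by (auto simp: null_like_def created_at_def)
qed

lemma adj_root_null:
  assumes \<rho>: "\<rho> \<in> generators T" and w: "adj \<rho> (root_null F \<rho>) w"
  shows "w = Ind 0"
proof -
  have "1 \<in> set_atom \<rho>" using root_null_occurs[OF \<rho>] w unfolding adj_def by force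
  then have "adj \<rho> (Ind 0) (root_null F \<rho>)"
    using can_root[OF \<rho>] generator_vars[OF \<rho>] by (cases \<rho>) (auto simp: adj_def at_pair_def)
  then show ?thesis using adj_child[OF \<rho> _ _ w] by (simp add: root_null_def)
qed

section \<open>A model of the ontology and a complete data instance\<close>

text \<open>Since the bodies of tgds are single atoms, a union of models is a model. So it suffices to
  attach to the data a copy of the canonical model of each of its atoms.\<close>

definition tag :: "nat atom \<Rightarrow> nat \<Rightarrow> nat \<Rightarrow> elem \<Rightarrow> nat + nat atom \<times> nat \<times> nat \<times> elem" where
  "tag \<rho> a b w = (if w = Ind 0 then Inl a else if w = root_null F \<rho> then Inl b else Inr (\<rho>, a, b, w))"

text \<open>The indices in \<open>tag\<close> keep the nulls of different copies apart. If 1 does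
  not occur in \<open>\<rho>\<close>, then \<open>b\<close> is arbitrary and just multiplies
  copies.\<close>

definition glued :: "nat atom set \<Rightarrow> (nat + nat atom \<times> nat \<times> nat \<times> elem) atom set" where
  "glued A = map_atom Inl ` A \<union> {map_atom (tag \<rho> a b) \<alpha> | \<rho> a b \<alpha>.
     \<rho> \<in> gens T \<and> map_atom (at_pair a b) \<rho> \<in> A \<and> \<alpha> \<in> can \<rho>}"

lemma gens_generators: "\<rho> \<in> gens T \<Longrightarrow> \<rho> \<in> generators T"
  using gens_subset_generators by blast

lemma tag_Inl_ind:
  assumes \<rho>: "\<rho> \<in> gens T" "map_atom (at_pair a b) \<rho> \<in> A" "\<alpha> \<in> can \<rho>" and w: "w \<in> set_atom \<alpha>" "tag \<rho> a b w = Inl i"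
  shows "i = (if w = Ind 0 then a else b)" "w = Ind 0 \<or> w = root_null F \<rho>" "i \<in> ind A"
proof -
  have v: "0 \<in> set_atom \<rho>" using generator_vars[OF gens_generators[OF \<rho>(1)]] by simp
  show "i = (if w = Ind 0 then a else b)" "w = Ind 0 \<or> w = root_null F \<rho>"
    using w(2) by (auto simp: tag_def split: if_splits)
  then have "\<exists>v\<in>set_atom \<rho>. at_pair a b v = i"
    using v root_null_occurs[OF gens_generators[OF \<rho>(1)] \<rho>(3)] w(1)
    by (cases "w = Ind 0") (force simp: at_pair_def)+
  then have "i \<in> set_atom (map_atom (at_pair a b) \<rho>)" by (auto simp: atom.set_map)
  then show "i \<in> ind A" using \<rho>(2) by (auto simp: ind_def)
qed

lemma glued_Inl_ind:
  assumes "\<beta> \<in> glued A" "Inl i \<in> set_atom \<beta>"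
  shows "i \<in> ind A"
proof -
  from assms(1) consider \<alpha> where "\<alpha> \<in> A" "\<beta> = map_atom Inl \<alpha>"
    | \<rho> a b \<alpha> where "\<rho> \<in> gens T" "map_atom (at_pair a b) \<rho> \<in> A" "\<alpha> \<in> can \<rho>" "\<beta> = map_atom (tag \<rho> a b) \<alpha>"
    unfolding glued_def by blast
  then show ?thesis
  proof cases
    case 1
    then show ?thesis using assms(2) by (auto simp: atom.set_map ind_def)
  next
    case 2
    then obtain w where "w \<in> set_atom \<alpha>" "tag \<rho> a b w = Inl i" using assms(2) by (force simp: atom.set_map)
    then show ?thesis using tag_Inl_ind(3)[OF 2(1-3)] by blast
  qed
qed

text \<open>A null carries the name of its copy, so all atoms containing it come from that
  copy.\<close>

lemma glued_Inr:
  assumes "\<beta> \<in> glued A" "Inr (\<rho>, a, b, n) \<in> set_atom \<beta>"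
  shows "\<rho> \<in> gens T" "map_atom (at_pair a b) \<rho> \<in> A" "n \<noteq> Ind 0" "n \<noteq> root_null F \<rho>"
    "\<exists>\<alpha>\<in>can \<rho>. \<beta> = map_atom (tag \<rho> a b) \<alpha>"
proof -
  have "Inr (\<rho>, a, b, n) \<notin> set_atom (map_atom Inl \<alpha>)" for \<alpha> by (auto simp: atom.set_map)
  then obtain \<rho>' a' b' \<alpha> where *: "\<rho>' \<in> gens T" "map_atom (at_pair a' b') \<rho>' \<in> A" "\<alpha> \<in> can \<rho>'" "\<beta> = map_atom (tag \<rho>' a' b') \<alpha>"
    using assms unfolding glued_def by blast
  then obtain w where "tag \<rho>' a' b' w = Inr (\<rho>, a, b, n)" using assms(2) by (force simp: atom.set_map)
  then have "\<rho>' = \<rho> \<and> a' = a \<and> b' = b \<and> n \<noteq> Ind 0 \<and> n \<noteq> root_null F \<rho>"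
    by (auto simp: tag_def split: if_splits)
  then show "\<rho> \<in> gens T" "map_atom (at_pair a b) \<rho> \<in> A" "n \<noteq> Ind 0" "n \<noteq> root_null F \<rho>"
    "\<exists>\<alpha>\<in>can \<rho>. \<beta> = map_atom (tag \<rho> a b) \<alpha>" using * by auto
qed

lemma is_model_at_pair:
  assumes "is_model T A D c I" "map_atom (at_pair a b) \<rho> \<in> A"
  shows "is_model T {\<rho>} D (at_pair (c a) (c b)) I"
proof -
  have "map_atom c (map_atom (at_pair a b) \<rho>) \<in> I" using assms by (auto simp: is_model_def)
  then have "map_atom (at_pair (c a) (c b)) \<rho> \<in> I" by (simp add: atom.map_comp comp_at_pair)
  moreover have "range (at_pair (c a) (c b)) \<subseteq> D" using assms by (auto simp: is_model_def at_pair_def)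
  ultimately show ?thesis using assms by (simp add: is_model_def)
qed

text \<open>By \<open>can_universal\<close>, an atom over individuals in a copy holds in every model
  of the data; completeness puts it into \<open>A\<close>.\<close>

lemma glued_Inl:
  assumes compl: "complete_instance TYPE('d) T A" and \<beta>: "map_atom Inl \<gamma> \<in> glued A"
  shows "\<gamma> \<in> A"
proof -
  have ind: "set_atom \<gamma> \<subseteq> ind A"
    using glued_Inl_ind[OF \<beta>] by (auto simp: atom.set_map)
  have Inl_eq: "map_atom Inl \<alpha> = map_atom Inl \<alpha>' \<Longrightarrow> \<alpha> = \<alpha>'" for \<alpha> \<alpha>' :: "nat atom"
    by (cases \<alpha>; cases \<alpha>') auto
  from \<beta> consider "\<gamma> \<in> A"
    | \<rho> a b \<alpha> where "\<rho> \<in> gens T" "map_atom (at_pair a b) \<rho> \<in> A" "\<alpha> \<in> can \<rho>" "map_atom Inl \<gamma> = map_atom (tag \<rho> a b) \<alpha>"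
    unfolding glued_def using Inl_eq by blast
  then show ?thesis
  proof cases
    case 2
    have Inl: "\<exists>i. tag \<rho> a b w = Inl i" if "w \<in> set_atom \<alpha>" for w
    proof -
      have "tag \<rho> a b w \<in> set_atom (map_atom Inl \<gamma>)" using that 2(4) by (simp add: atom.set_map)
      then show ?thesis by (auto simp: atom.set_map)
    qed
    have "entails_atom TYPE('d) T A \<gamma>"
      unfolding entails_atom_def
    proof (intro allI impI)
      fix D :: "'d set" and c I assume M: "is_model T A D c I"
      obtain h where h: "h (Ind 0) = at_pair (c a) (c b) 0" "h (root_null F \<rho>) = at_pair (c a) (c b) 1"
        "\<And>\<alpha>. \<alpha> \<in> can \<rho> \<Longrightarrow> map_atom h \<alpha> \<in> I"
        using can_universal[OF gens_generators[OF 2(1)] is_model_at_pair[OF M 2(2)]] by metis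
      \<comment> \<open>All elements of this atom are tagged as individuals, so
        \<open>undefined\<close> is never reached.\<close>
      have "map_atom h \<alpha> = map_atom (case_sum c undefined) (map_atom (tag \<rho> a b) \<alpha>)"
        unfolding atom.map_comp map_atom_eq_iff
        using Inl tag_Inl_ind(1,2)[OF 2(1-3)] h(1,2) by (fastforce simp: at_pair_def)
      also have "\<dots> = map_atom c \<gamma>" unfolding 2(4)[symmetric] atom.map_comp map_atom_eq_iff by simp
      finally show "map_atom c \<gamma> \<in> I" using h(3)[OF 2(3)] by simp
    qed
    then show ?thesis using compl ind unfolding complete_instance_def by blast
  qed
qed

text \<open>A body instance lies in one copy: that of its null if it has one; otherwise it is a data
  atom by \<open>glued_Inl\<close> and lies in the copy of its own generator. That copy satisfies
  the tgd.\<close>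

lemma glued_sat_tgd:
  assumes compl: "complete_instance TYPE('d) T A" and \<tau>: "\<tau> \<in> T"
  shows "sat_tgd UNIV (glued A) \<tau>"
  unfolding sat_tgd_def
proof (intro allI impI)
  fix \<nu> assume \<nu>: "map_atom \<nu> (body \<tau>) \<in> glued A"
  have "\<exists>\<rho> a b \<nu>0. \<rho> \<in> gens T \<and> map_atom (at_pair a b) \<rho> \<in> A \<and> map_atom \<nu>0 (body \<tau>) \<in> can \<rho> \<and>
      (\<forall>v\<in>set_atom (body \<tau>). \<nu> v = tag \<rho> a b (\<nu>0 v))"
  proof (cases "\<exists>v\<in>set_atom (body \<tau>). \<exists>x. \<nu> v = Inr x")
    case True
    then obtain v \<rho> a b n where v: "v \<in> set_atom (body \<tau>)" "\<nu> v = Inr (\<rho>, a, b, n)" by (metis prod.exhaust)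
    then have n: "Inr (\<rho>, a, b, n) \<in> set_atom (map_atom \<nu> (body \<tau>))" by (force simp: atom.set_map)
    note G = glued_Inr[OF \<nu> n]
    then obtain \<alpha> where \<alpha>: "\<alpha> \<in> can \<rho>" "map_atom \<nu> (body \<tau>) = map_atom (tag \<rho> a b) \<alpha>" by blast
    have tag_Inr: "tag \<rho> a b w = Inr (\<rho>, a, b, n) \<Longrightarrow> w = n" for w by (auto simp: tag_def split: if_splits)
    have "\<exists>\<nu>0. map_atom \<nu>0 (body \<tau>) = \<alpha> \<and> (\<forall>v\<in>set_atom (body \<tau>). \<nu> v = tag \<rho> a b (\<nu>0 v))"
    proof (cases "body \<tau>")
      case (Unary P x)
      then obtain w where "\<alpha> = Unary P w" using \<alpha>(2) by (cases \<alpha>) auto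
      then show ?thesis using Unary \<alpha>(2) by (intro exI[of _ "\<lambda>_. w"]) auto
    next
      case (Binary R x y)
      then obtain w w' where w: "\<alpha> = Binary R w w'" using \<alpha>(2) by (cases \<alpha>) auto
      \<comment> \<open>\<open>tag\<close> is not injective if \<open>a = b\<close>, but the
        preimage of a tagged null is unique.\<close>
      have "x = y \<Longrightarrow> w = w'" using v Binary w \<alpha>(2) tag_Inr[of w] tag_Inr[of w'] by auto
      then show ?thesis using Binary w \<alpha>(2) by (intro exI[of _ "\<lambda>v. if v = x then w else w'"]) auto
    qed
    then show ?thesis using G(1,2) \<alpha>(1) by metis
  next
    case False
    then have "\<forall>v\<in>set_atom (body \<tau>). \<nu> v = (Inl \<circ> (projl \<circ> \<nu>)) v" by (metis comp_apply sum.collapse(1) isl_def sum.exhaust)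
    then have eq: "map_atom \<nu> (body \<tau>) = map_atom Inl (map_atom (projl \<circ> \<nu>) (body \<tau>))"
      by (simp add: atom.map_comp map_atom_eq_iff)
    define i where "i = projl \<circ> \<nu>"
    have A: "map_atom i (body \<tau>) \<in> A" using glued_Inl[OF compl] \<nu> eq unfolding i_def by metis
    have \<nu>i: "\<forall>v\<in>set_atom (body \<tau>). \<nu> v = Inl (i v)" using eq by (simp add: atom.map_comp map_atom_eq_iff i_def)
    show ?thesis
    proof (cases "body \<tau>")
      case (Unary P x)
      then have \<rho>: "Unary P 0 \<in> gens T" using \<tau> by (force simp: gens_def)
      have "Unary P (Ind 0) \<in> can (Unary P 0)" using can_root[OF gens_generators[OF \<rho>]] by (simp add: at_pair_def)
      then show ?thesis using A \<nu>i Unary \<rho>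
        by (intro exI[of _ "Unary P 0"] exI[of _ "i x"] exI[of _ "\<lambda>_. Ind 0"]) (simp add: at_pair_def tag_def)
    next
      case (Binary R x y)
      show ?thesis
      proof (cases "x = y")
        case True
        have \<rho>: "Binary R 0 0 \<in> gens T" using \<tau> Binary by (force simp: gens_def)
        have "Binary R (Ind 0) (Ind 0) \<in> can (Binary R 0 0)" using can_root[OF gens_generators[OF \<rho>]] by (simp add: at_pair_def)
        then show ?thesis using A \<nu>i Binary True \<rho>
          by (intro exI[of _ "Binary R 0 0"] exI[of _ "i x"] exI[of _ "\<lambda>_. Ind 0"]) (simp add: at_pair_def tag_def)
      next
        case False
        let ?\<rho> = "Binary R 0 1" let ?n = "root_null F ?\<rho>"
        have \<rho>: "?\<rho> \<in> gens T" using \<tau> Binary by (force simp: gens_def)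
        have "Binary R (Ind 0) ?n \<in> can ?\<rho>" using can_root[OF gens_generators[OF \<rho>]] by (simp add: at_pair_def)
        moreover have "?n \<noteq> Ind 0" by (simp add: root_null_def)
        ultimately show ?thesis using A \<nu>i Binary False \<rho>
          by (intro exI[of _ ?\<rho>] exI[of _ "i x"] exI[of _ "i y"] exI[of _ "\<lambda>v. if v = x then Ind 0 else ?n"])
            (simp add: at_pair_def tag_def)
      qed
    qed
  qed
  then obtain \<rho> a b \<nu>0 where *: "\<rho> \<in> gens T" "map_atom (at_pair a b) \<rho> \<in> A" "map_atom \<nu>0 (body \<tau>) \<in> can \<rho>"
    "\<forall>v\<in>set_atom (body \<tau>). \<nu> v = tag \<rho> a b (\<nu>0 v)" by blast
  obtain \<mu> where \<mu>: "\<forall>v\<in>set_atom (body \<tau>). \<mu> v = \<nu>0 v" "\<forall>\<psi>\<in>set (head \<tau>). map_atom \<mu> \<psi> \<in> can \<rho>"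
    using can_sat_tgd[OF \<tau>, of \<rho>] *(3) unfolding sat_tgd_def by blast
  have "map_atom (tag \<rho> a b \<circ> \<mu>) \<psi> \<in> glued A" if "\<psi> \<in> set (head \<tau>)" for \<psi>
    using *(1,2) \<mu>(2) that unfolding glued_def atom.map_comp[symmetric] by blast
  then show "\<exists>\<mu>. range \<mu> \<subseteq> UNIV \<and> (\<forall>v\<in>set_atom (body \<tau>). \<mu> v = \<nu> v) \<and>
      (\<forall>\<psi>\<in>set (head \<tau>). map_atom \<mu> \<psi> \<in> glued A)"
    using *(4) \<mu>(1) by (intro exI[of _ "tag \<rho> a b \<circ> \<mu>"]) simp
qed

lemma is_model_glued:
  "complete_instance TYPE('d) T A \<Longrightarrow> is_model T A UNIV Inl (glued A)"
  using glued_sat_tgd by (auto simp: is_model_def glued_def)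

end

text \<open>An infinite type contains a copy of every countable model, with domain
  \<open>range g\<close>; a match in the copy is pulled back along the injection.\<close>

lemma entails_cq_countable:
  fixes I :: "'c :: countable atom set"
  assumes inf: "infinite (UNIV :: 'd set)" and ent: "entails_cq TYPE('d) T A q as"
    and M: "is_model T A UNIV c I"
  shows "sat_cq UNIV I q (map c as)"
proof -
  obtain e :: "nat \<Rightarrow> 'd" where "inj e" using infinite_countable_subset[OF inf] by blast
  define g :: "'c \<Rightarrow> 'd" where "g = e \<circ> to_nat"
  have g: "inj g" unfolding g_def using \<open>inj e\<close> by (simp add: inj_compose)
  then have inv_g: "inv g (g x) = x" for x by simp
  have pull: "map_atom (inv g \<circ> \<nu>) \<alpha> \<in> I" if img: "map_atom \<nu> \<alpha> \<in> map_atom g ` I" for \<nu> and \<alpha> :: "nat atom"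
  proof -
    obtain \<beta> where "\<beta> \<in> I" "map_atom \<nu> \<alpha> = map_atom g \<beta>" using img by blast
    then have "map_atom (inv g \<circ> \<nu>) \<alpha> = map_atom (inv g \<circ> g) \<beta>" by (metis atom.map_comp)
    then show ?thesis using \<open>\<beta> \<in> I\<close> g by (simp add: atom.map_id)
  qed
  have "is_model T A (range g) (g \<circ> c) (map_atom g ` I)"
    unfolding is_model_def
  proof (intro conjI ballI)
    fix \<tau> assume "\<tau> \<in> T"
    then have sat: "sat_tgd UNIV I \<tau>" using M by (simp add: is_model_def)
    show "sat_tgd (range g) (map_atom g ` I) \<tau>"
      unfolding sat_tgd_def
    proof (intro allI impI)
      fix \<nu> :: "nat \<Rightarrow> 'd" assume rng: "range \<nu> \<subseteq> range g" and "map_atom \<nu> (body \<tau>) \<in> map_atom g ` I"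
      then have "map_atom (inv g \<circ> \<nu>) (body \<tau>) \<in> I" by (intro pull)
      then obtain \<mu> where \<mu>: "\<forall>v\<in>set_atom (body \<tau>). \<mu> v = (inv g \<circ> \<nu>) v" "\<forall>\<psi>\<in>set (head \<tau>). map_atom \<mu> \<psi> \<in> I"
        using sat unfolding sat_tgd_def by blast
      have "g (inv g (\<nu> v)) = \<nu> v" for v using rng by (metis f_inv_into_f range_subsetD)
      then show "\<exists>\<mu>. range \<mu> \<subseteq> range g \<and> (\<forall>v\<in>set_atom (body \<tau>). \<mu> v = \<nu> v) \<and>
          (\<forall>\<psi>\<in>set (head \<tau>). map_atom \<mu> \<psi> \<in> map_atom g ` I)"
        using \<mu> by (intro exI[of _ "g \<circ> \<mu>"]) (auto simp: atom.map_comp[symmetric])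
    qed
  next
    fix \<alpha> assume "\<alpha> \<in> A"
    then show "map_atom (g \<circ> c) \<alpha> \<in> map_atom g ` I"
      using M by (auto simp: is_model_def atom.map_comp[symmetric])
  qed (auto simp: ind_def atom.set_map)
  then have "sat_cq (range g) (map_atom g ` I) q (map (g \<circ> c) as)"
    using ent unfolding entails_cq_def by blast
  then obtain \<mu> where \<mu>: "map \<mu> (answer_vars q) = map (g \<circ> c) as"
    "\<forall>\<alpha>\<in>set (cq_atoms q). map_atom \<mu> \<alpha> \<in> map_atom g ` I" unfolding sat_cq_def by blast
  have "map (inv g) (map \<mu> (answer_vars q)) = map (inv g) (map (g \<circ> c) as)" using \<mu>(1) by simp
  then have "map (inv g \<circ> \<mu>) (answer_vars q) = map c as" by (simp add: inv_g)
  then show ?thesis using \<mu>(2) pull unfolding sat_cq_def by (intro exI[of _ "inv g \<circ> \<mu>"]) simp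
qed

section \<open>Selections of the variables mapped to nulls\<close>

definition cq_vars :: "cq \<Rightarrow> nat set" where
  "cq_vars q = (\<Union>\<alpha>\<in>set (cq_atoms q). set_atom \<alpha>)"

definition nbr :: "cq \<Rightarrow> nat \<Rightarrow> nat \<Rightarrow> bool" where
  "nbr q u v \<longleftrightarrow> u \<noteq> v \<and> (\<exists>\<alpha>\<in>set (cq_atoms q). set_atom \<alpha> = {u, v})"

definition conn :: "cq \<Rightarrow> nat rel" where
  "conn q = {(u, v). \<exists>\<alpha>\<in>set (cq_atoms q). u \<in> set_atom \<alpha> \<and> v \<in> set_atom \<alpha>}\<^sup>*"

definition component :: "cq \<Rightarrow> nat \<Rightarrow> nat atom list" where
  "component q u = filter (\<lambda>\<alpha>. \<exists>v\<in>set_atom \<alpha>. (u, v) \<in> conn q) (cq_atoms q)"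

definition star :: "cq \<Rightarrow> nat \<Rightarrow> nat atom list" where
  "star q u = map (map_atom (\<lambda>v. if v = u then 1 else 0)) (filter (\<lambda>\<alpha>. u \<in> set_atom \<alpha>) (cq_atoms q))"

text \<open>In the following \<open>ge \<beta>s\<close> stands for the generators entailing the Boolean query with atoms
  \<open>\<beta>s\<close>, and \<open>gs u\<close> for those entailing the star of \<open>u\<close> with all neighbours of \<open>u\<close> identified with the
  root. A whole component of the query can be mapped to a part of the canonical model without
  individuals if it \<open>escapes\<close>.\<close>

definition escapes :: "cq \<Rightarrow> (nat atom list \<Rightarrow> nat atom list) \<Rightarrow> nat atom set \<Rightarrow> nat \<Rightarrow> bool" where
  "escapes q ge A u \<longleftrightarrow> (\<forall>x\<in>set (answer_vars q). (u, x) \<notin> conn q) \<and>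
     (\<exists>\<rho>\<in>set (ge (component q u)). \<exists>a\<in>ind A. \<exists>b\<in>ind A. map_atom (at_pair a b) \<rho> \<in> A)"

text \<open>A neighbour is demanded because its value names the individual below which the null
  hangs.\<close>

definition foldable :: "cq \<Rightarrow> (nat \<Rightarrow> nat atom list) \<Rightarrow> nat atom set \<Rightarrow> (nat \<Rightarrow> nat) \<Rightarrow> nat \<Rightarrow> bool" where
  "foldable q gs A \<nu> u \<longleftrightarrow> u \<notin> set (answer_vars q) \<and>
     (\<exists>w. nbr q u w \<and> (\<forall>v. nbr q u v \<longrightarrow> \<nu> v = \<nu> w) \<and>
       (\<exists>\<rho>\<in>set (gs u). \<exists>b\<in>ind A. map_atom (at_pair (\<nu> w) b) \<rho> \<in> A))"

text \<open>For fixed \<open>\<nu>\<close> these are clauses over the \<open>Y u\<close> with at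
  most two literals, as an atom has at most two variables.\<close>

definition selection :: "cq \<Rightarrow> (nat atom list \<Rightarrow> nat atom list) \<Rightarrow> (nat \<Rightarrow> nat atom list) \<Rightarrow>
    nat atom set \<Rightarrow> (nat \<Rightarrow> nat) \<Rightarrow> (nat \<Rightarrow> bool) \<Rightarrow> bool" where
  "selection q ge gs A \<nu> Y \<longleftrightarrow>
     (\<forall>\<alpha>\<in>set (cq_atoms q). map_atom \<nu> \<alpha> \<in> A \<or> (\<exists>u\<in>set_atom \<alpha>. escapes q ge A u \<or> Y u)) \<and>
     (\<forall>u. Y u \<longrightarrow> foldable q gs A \<nu> u) \<and> (\<forall>u v. nbr q u v \<longrightarrow> \<not> (Y u \<and> Y v))"

lemma nbr_sym: "nbr q u v \<Longrightarrow> nbr q v u"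
  by (auto simp: nbr_def insert_commute)

lemma nbrI: "\<alpha> \<in> set (cq_atoms q) \<Longrightarrow> u \<in> set_atom \<alpha> \<Longrightarrow> v \<in> set_atom \<alpha> \<Longrightarrow> u \<noteq> v \<Longrightarrow> nbr q u v"
  unfolding nbr_def by (cases \<alpha>) force+

lemma conn_atom: "\<alpha> \<in> set (cq_atoms q) \<Longrightarrow> u \<in> set_atom \<alpha> \<Longrightarrow> v \<in> set_atom \<alpha> \<Longrightarrow> (u, v) \<in> conn q"
  unfolding conn_def by blast

lemma conn_trans: "(u, v) \<in> conn q \<Longrightarrow> (v, w) \<in> conn q \<Longrightarrow> (u, w) \<in> conn q"
  unfolding conn_def by (rule rtrancl_trans)

lemma conn_sym: "(u, v) \<in> conn q \<Longrightarrow> (v, u) \<in> conn q"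
proof -
  have "sym (conn q)" unfolding conn_def by (rule sym_rtrancl) (auto simp: sym_def)
  then show "(u, v) \<in> conn q \<Longrightarrow> (v, u) \<in> conn q" by (rule symD)
qed

lemma conn_cong:
  assumes "(u, v) \<in> conn q"
  shows "component q u = component q v" "escapes q ge A u = escapes q ge A v"
proof -
  have "(u, w) \<in> conn q \<longleftrightarrow> (v, w) \<in> conn q" for w
    using assms conn_sym conn_trans by blast
  then show "component q u = component q v" "escapes q ge A u = escapes q ge A v"
    by (simp_all add: component_def escapes_def)
qed

section \<open>Selections and certain answers\<close>

context shallow
begin

lemma selection_sound:
  assumes ge: "\<And>\<beta>s \<rho>. \<rho> \<in> set (ge \<beta>s) \<Longrightarrow> entails_cq TYPE('d) T {\<rho>} (CQ [] \<beta>s) []"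
    and gs: "\<And>u \<rho>. \<rho> \<in> set (gs u) \<Longrightarrow> entails_cq TYPE('d) T {\<rho>} (CQ [0] (star q u)) [0]"
    and sel: "selection q ge gs A \<nu> Y"
  shows "entails_cq TYPE('d) T A q (map \<nu> (answer_vars q))"
  unfolding entails_cq_def
proof (intro allI impI)
  fix D :: "'d set" and c I
  assume M: "is_model T A D c I"
  have ex_f: "\<exists>\<kappa>. range \<kappa> \<subseteq> D \<and> (\<forall>\<alpha>\<in>set (component q u). map_atom \<kappa> \<alpha> \<in> I)"
    if u: "escapes q ge A u" for u
  proof -
    let ?\<beta>s = "component q u"
    obtain \<rho> a b where "\<rho> \<in> set (ge ?\<beta>s)" "map_atom (at_pair a b) \<rho> \<in> A"
      using u unfolding escapes_def by blast
    then have "sat_cq D I (CQ [] ?\<beta>s) (map (at_pair (c a) (c b)) [])"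
      using ge is_model_at_pair[OF M] unfolding entails_cq_def by blast
    then show ?thesis unfolding sat_cq_def by auto
  qed
  \<comment> \<open>The choice depends on the list of atoms alone, so connected variables use the
    same assignment.\<close>
  define f where "f \<beta>s = (SOME \<kappa>. range \<kappa> \<subseteq> D \<and> (\<forall>\<alpha>\<in>set \<beta>s. map_atom \<kappa> \<alpha> \<in> I))" for \<beta>s :: "nat atom list"
  have f: "range (f (component q u)) \<subseteq> D \<and>
      (\<forall>\<alpha>\<in>set (component q u). map_atom (f (component q u)) \<alpha> \<in> I)" if "escapes q ge A u" for u
    unfolding f_def using someI_ex[OF ex_f[OF that]] .
  \<comment> \<open>The neighbours of \<open>u\<close> share one value, so a match of the star with
    its root at that value extends the assignment by an image of \<open>u\<close>.\<close>
  have ex_g: "\<exists>d. d \<in> D \<and> (\<forall>\<alpha>\<in>set (cq_atoms q). u \<in> set_atom \<alpha> \<longrightarrow>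
      map_atom (\<lambda>v. if v = u then d else c (\<nu> v)) \<alpha> \<in> I)" if u: "Y u" for u
  proof -
    have "foldable q gs A \<nu> u" using sel u by (simp add: selection_def)
    then obtain w \<rho> b where w: "\<forall>v. nbr q u v \<longrightarrow> \<nu> v = \<nu> w" and \<rho>: "\<rho> \<in> set (gs u)"
      "map_atom (at_pair (\<nu> w) b) \<rho> \<in> A" unfolding foldable_def by blast
    have "sat_cq D I (CQ [0] (star q u)) (map (at_pair (c (\<nu> w)) (c b)) [0])"
      using gs[OF \<rho>(1)] is_model_at_pair[OF M \<rho>(2)] unfolding entails_cq_def by blast
    then obtain \<kappa> where \<kappa>: "range \<kappa> \<subseteq> D" "\<kappa> 0 = c (\<nu> w)" "\<forall>\<alpha>\<in>set (star q u). map_atom \<kappa> \<alpha> \<in> I"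
      unfolding sat_cq_def by (auto simp: at_pair_def)
    have "map_atom (\<lambda>v. if v = u then \<kappa> 1 else c (\<nu> v)) \<alpha> \<in> I"
      if \<alpha>: "\<alpha> \<in> set (cq_atoms q)" "u \<in> set_atom \<alpha>" for \<alpha>
    proof -
      have "map_atom \<kappa> (map_atom (\<lambda>v. if v = u then 1 else 0) \<alpha>) \<in> I"
        using \<kappa>(3) \<alpha> by (auto simp: star_def)
      moreover have "map_atom \<kappa> (map_atom (\<lambda>v. if v = u then 1 else 0) \<alpha>) = map_atom (\<lambda>v. if v = u then \<kappa> 1 else c (\<nu> v)) \<alpha>"
        unfolding atom.map_comp map_atom_eq_iff using w nbrI[OF \<alpha>] \<kappa>(2) by auto
      ultimately show ?thesis by simp
    qed
    then show ?thesis using \<kappa>(1) by blast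
  qed
  define g where "g u = (SOME d. d \<in> D \<and> (\<forall>\<alpha>\<in>set (cq_atoms q). u \<in> set_atom \<alpha> \<longrightarrow>
      map_atom (\<lambda>v. if v = u then d else c (\<nu> v)) \<alpha> \<in> I))" for u
  have g: "g u \<in> D" "\<And>\<alpha>. \<alpha> \<in> set (cq_atoms q) \<Longrightarrow> u \<in> set_atom \<alpha> \<Longrightarrow>
      map_atom (\<lambda>v. if v = u then g u else c (\<nu> v)) \<alpha> \<in> I" if "Y u" for u
    using someI_ex[OF ex_g[OF that], folded g_def] by blast+
  define \<kappa> where "\<kappa> x = (if escapes q ge A x then f (component q x) x else if Y x then g x else c (\<nu> x))" for x
  have "map_atom \<kappa> \<alpha> \<in> I" if \<alpha>: "\<alpha> \<in> set (cq_atoms q)" for \<alpha>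
  proof -
    consider (esc) u where "u \<in> set_atom \<alpha>" "escapes q ge A u"
      | (null) u where "u \<in> set_atom \<alpha>" "Y u" "\<forall>v\<in>set_atom \<alpha>. \<not> escapes q ge A v"
      | (data) "map_atom \<nu> \<alpha> \<in> A" "\<forall>v\<in>set_atom \<alpha>. \<not> escapes q ge A v \<and> \<not> Y v"
      using sel \<alpha> unfolding selection_def by blast
    then show ?thesis
    proof cases
      case esc
      have "escapes q ge A v \<and> component q v = component q u" if "v \<in> set_atom \<alpha>" for v
        using conn_cong[OF conn_atom[OF \<alpha> that esc(1)]] esc(2) by blast
      then have "map_atom \<kappa> \<alpha> = map_atom (f (component q u)) \<alpha>"
        unfolding map_atom_eq_iff by (simp add: \<kappa>_def)
      moreover have "\<alpha> \<in> set (component q u)"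
        using \<alpha> esc(1) by (auto simp: component_def conn_def)
      ultimately show ?thesis using f[OF esc(2)] by simp
    next
      case null
      have "\<not> Y v" if "v \<in> set_atom \<alpha>" "v \<noteq> u" for v
        using nbrI[OF \<alpha> null(1) that(1)] that(2) sel null(2) unfolding selection_def by blast
      then have "map_atom \<kappa> \<alpha> = map_atom (\<lambda>v. if v = u then g u else c (\<nu> v)) \<alpha>"
        unfolding map_atom_eq_iff using null by (simp add: \<kappa>_def)
      then show ?thesis using g(2)[OF null(2) \<alpha> null(1)] by simp
    next
      case data
      then have "map_atom \<kappa> \<alpha> = map_atom c (map_atom \<nu> \<alpha>)"
        unfolding atom.map_comp map_atom_eq_iff by (simp add: \<kappa>_def)
      then show ?thesis using M data(1) by (simp add: is_model_def)
    qed
  qed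
  moreover have "map \<kappa> (answer_vars q) = map c (map \<nu> (answer_vars q))"
  proof -
    have "\<not> escapes q ge A x \<and> \<not> Y x" if "x \<in> set (answer_vars q)" for x
      using that sel by (auto simp: escapes_def selection_def foldable_def conn_def)
    then show ?thesis by (simp add: \<kappa>_def)
  qed
  moreover have "range \<kappa> \<subseteq> D"
    using f g(1) M unfolding \<kappa>_def is_model_def by (auto simp: image_subset_iff)
  ultimately show "sat_cq D I q (map c (map \<nu> (answer_vars q)))"
    unfolding sat_cq_def by blast
qed

text \<open>Formulas quantify over \<open>ind A\<close> only; if the second value is a dummy,
  \<open>a\<close> takes its place.\<close>

lemma generator_instance_ind:
  assumes "\<rho> \<in> gens T" "map_atom (at_pair a b) \<rho> \<in> A"
  shows "a \<in> ind A" "\<exists>b'\<in>ind A. map_atom (at_pair a b') \<rho> \<in> A"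
proof -
  have \<rho>: "0 \<in> set_atom \<rho>" "set_atom \<rho> \<subseteq> {0, 1}" using generator_vars[OF gens_generators[OF assms(1)]] by auto
  have in_ind: "at_pair a b v \<in> ind A" if "v \<in> set_atom \<rho>" for v
    using that assms(2) unfolding ind_def by (metis UN_I atom.set_map imageI)
  show a: "a \<in> ind A" using in_ind[OF \<rho>(1)] by (simp add: at_pair_def)
  show "\<exists>b'\<in>ind A. map_atom (at_pair a b') \<rho> \<in> A"
  proof (cases "1 \<in> set_atom \<rho>")
    case True
    then show ?thesis using in_ind[of 1] assms(2) by (auto simp: at_pair_def)
  next
    case False
    then have "map_atom (at_pair a a) \<rho> = map_atom (at_pair a b) \<rho>"
      unfolding map_atom_eq_iff using \<rho> by (auto simp: at_pair_def)
    then show ?thesis using a assms(2) by (intro bexI[of _ a]) simp_all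
  qed
qed

lemma selection_complete:
  assumes inf: "infinite (UNIV :: 'd set)"
    and compl: "complete_instance TYPE('d) T A"
    and ge: "\<And>\<beta>s \<rho>. \<rho> \<in> gens T \<Longrightarrow> entails_cq TYPE('d) T {\<rho>} (CQ [] \<beta>s) [] \<Longrightarrow> \<rho> \<in> set (ge \<beta>s)"
    and gs: "\<And>u \<rho>. \<rho> \<in> gens T \<Longrightarrow> entails_cq TYPE('d) T {\<rho>} (CQ [0] (star q u)) [0] \<Longrightarrow> \<rho> \<in> set (gs u)"
    and ent: "entails_cq TYPE('d) T A q (map \<nu> (answer_vars q))"
  obtains \<nu>' Y where "\<And>x. x \<notin> cq_vars q - set (answer_vars q) \<Longrightarrow> \<nu>' x = \<nu> x"
    "\<nu>' ` cq_vars q \<subseteq> ind A" "selection q ge gs A \<nu>' Y"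
proof -
  have "sat_cq UNIV (glued A) q (map Inl (map \<nu> (answer_vars q)))"
    by (rule entails_cq_countable[OF inf ent is_model_glued[OF compl]])
  then obtain \<mu> where ans: "map \<mu> (answer_vars q) = map (Inl \<circ> \<nu>) (answer_vars q)"
    and \<mu>: "\<And>\<alpha>. \<alpha> \<in> set (cq_atoms q) \<Longrightarrow> map_atom \<mu> \<alpha> \<in> glued A"
    unfolding sat_cq_def by auto
  have ans: "\<mu> x = Inl (\<nu> x)" if "x \<in> set (answer_vars q)" for x using ans that by simp
  \<comment> \<open>Selected are the variables at nulls with a neighbour at an individual; a
    variable at a null that is not selected turns out to escape.\<close>
  define Y where "Y x \<longleftrightarrow> (\<exists>y. \<mu> x = Inr y) \<and> (\<exists>v i. nbr q x v \<and> \<mu> v = Inl i)" for x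
  \<comment> \<open>Variables at nulls also need a value in \<open>ind A\<close>; the root of their
    copy is at hand.\<close>
  define \<nu>' where "\<nu>' x = (if x \<in> cq_vars q - set (answer_vars q)
    then case \<mu> x of Inl i \<Rightarrow> i | Inr (\<rho>, a, b, n) \<Rightarrow> a else \<nu> x)" for x
  have \<nu>'_Inl: "\<nu>' x = i" if "x \<in> cq_vars q" "\<mu> x = Inl i" for x i
    using that ans by (auto simp: \<nu>'_def)
  have atom_in: "\<mu> x \<in> set_atom (map_atom \<mu> \<alpha>)" if "x \<in> set_atom \<alpha>" for x \<alpha>
    using that by (simp add: atom.set_map)
  have nbr_vars: "u \<in> cq_vars q \<and> v \<in> cq_vars q" if "nbr q u v" for u v
    using that by (auto simp: nbr_def cq_vars_def)
  have null: "\<rho> \<in> gens T \<and> map_atom (at_pair a b) \<rho> \<in> A \<and> n \<noteq> Ind 0 \<and> n \<noteq> root_null F \<rho>"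
    if x: "x \<in> cq_vars q" "\<mu> x = Inr (\<rho>, a, b, n)" for x \<rho> a b n
  proof -
    obtain \<alpha> where "\<alpha> \<in> set (cq_atoms q)" "x \<in> set_atom \<alpha>" using x by (auto simp: cq_vars_def)
    then show ?thesis using glued_Inr(1-4)[OF \<mu>, of \<alpha> \<rho> a b n] atom_in[of x \<alpha>] x by auto
  qed
  have tag_Inr: "tag \<rho> a b w = Inr (\<rho>, a, b, n) \<Longrightarrow> w = n" for \<rho> a b w n
    by (auto simp: tag_def split: if_splits)
  have nbr_adj: "\<exists>w. adj \<rho> n w \<and> \<mu> v = tag \<rho> a b w" if x: "nbr q x v" "\<mu> x = Inr (\<rho>, a, b, n)" for x v \<rho> a b n
  proof -
    obtain \<alpha> where \<alpha>: "\<alpha> \<in> set (cq_atoms q)" "set_atom \<alpha> = {x, v}" "x \<noteq> v" using x(1) by (auto simp: nbr_def)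
    then have "Inr (\<rho>, a, b, n) \<in> set_atom (map_atom \<mu> \<alpha>)" using atom_in[of x \<alpha>] x(2) by simp
    then obtain \<beta> where \<beta>: "\<beta> \<in> can \<rho>" "map_atom \<mu> \<alpha> = map_atom (tag \<rho> a b) \<beta>"
      using glued_Inr(5)[OF \<mu>[OF \<alpha>(1)]] by blast
    obtain R y z where "\<alpha> = Binary R y z" "y = x \<and> z = v \<or> y = v \<and> z = x"
      using \<alpha>(2,3) by (cases \<alpha>) (auto simp: doubleton_eq_iff)
    moreover from this(1) obtain w w' where "\<beta> = Binary R w w'" using \<beta>(2) by (cases \<beta>) auto
    ultimately show ?thesis
      using \<beta> x(2) tag_Inr[of \<rho> a b w n] tag_Inr[of \<rho> a b w' n] unfolding adj_def by fastforce
  qed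
  \<comment> \<open>A neighbour at an individual comes from \<open>Ind 0\<close> or
    \<open>root_null\<close>; the latter has no neighbour but \<open>Ind 0\<close>.\<close>
  have child: "adj \<rho> n (Ind 0)" "\<And>w. adj \<rho> n w \<Longrightarrow> w = Ind 0" if Y: "Y x" and x: "\<mu> x = Inr (\<rho>, a, b, n)" for x \<rho> a b n
  proof -
    obtain v i where v: "nbr q x v" "\<mu> v = Inl i" using Y by (auto simp: Y_def)
    then obtain w where w: "adj \<rho> n w" "tag \<rho> a b w = Inl i" using nbr_adj[OF v(1) x] by auto
    have n: "\<rho> \<in> generators T" "n \<noteq> Ind 0" using null[OF _ x] nbr_vars[OF v(1)] gens_generators by auto
    have "w = Ind 0 \<or> w = root_null F \<rho>" using w(2) by (auto simp: tag_def split: if_splits)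
    moreover have "w \<noteq> root_null F \<rho>" using adj_root_null[OF n(1)] adj_sym[OF w(1)] n(2) by blast
    ultimately show "adj \<rho> n (Ind 0)" using w(1) by blast
    then show "w = Ind 0" if "adj \<rho> n w" for w using adj_child[OF n(1) adj_sym n(2) that] by blast
  qed
  have Y_nbr: "\<mu> v = Inl a" if "Y x" "\<mu> x = Inr (\<rho>, a, b, n)" "nbr q x v" for x v \<rho> a b n
    using nbr_adj[OF that(3,2)] child(2)[OF that(1,2)] by (auto simp: tag_def)
  have Y_fold: "foldable q gs A \<nu>' x" if Y: "Y x" for x
  proof -
    obtain \<rho> a b n where x: "\<mu> x = Inr (\<rho>, a, b, n)" using Y by (metis Y_def prod.exhaust)
    obtain w where w: "nbr q x w" using Y by (auto simp: Y_def)
    have \<nu>'a: "\<nu>' v = a" if "nbr q x v" for v using Y_nbr[OF Y x that] \<nu>'_Inl nbr_vars[OF that] by blast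
    have \<rho>: "\<rho> \<in> gens T" "map_atom (at_pair a b) \<rho> \<in> A" using null[OF _ x] nbr_vars[OF w] by auto
    \<comment> \<open>With \<open>x\<close> at \<open>n\<close> and its neighbours at
      \<open>Ind 0\<close>, the star holds in \<open>can \<rho>\<close>, and from there it maps into
      every model of \<open>\<rho>\<close>.\<close>
    have "entails_cq TYPE('d) T {\<rho>} (CQ [0] (star q x)) [0]"
      unfolding entails_cq_def
    proof (intro allI impI)
      fix D :: "'d set" and c I assume "is_model T {\<rho>} D c I"
      then obtain h where h: "range h \<subseteq> D" "h (Ind 0) = c 0" "\<And>\<alpha>. \<alpha> \<in> can \<rho> \<Longrightarrow> map_atom h \<alpha> \<in> I"
        using can_universal[OF gens_generators[OF \<rho>(1)]] by metis
      have "map_atom (at_pair (c 0) (h n)) (map_atom (\<lambda>v. if v = x then 1 else 0) \<alpha>) \<in> I"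
        if \<alpha>: "\<alpha> \<in> set (cq_atoms q)" "x \<in> set_atom \<alpha>" for \<alpha>
      proof -
        obtain \<beta> where \<beta>: "\<beta> \<in> can \<rho>" "map_atom \<mu> \<alpha> = map_atom (tag \<rho> a b) \<beta>"
          using glued_Inr(5)[OF \<mu>[OF \<alpha>(1)]] atom_in[OF \<alpha>(2)] x by metis
        have "\<beta> = map_atom (\<lambda>v. if v = x then n else Ind 0) \<alpha>"
        proof (cases \<alpha>)
          case (Unary P y)
          then show ?thesis using \<alpha>(2) \<beta>(2) x tag_Inr by (cases \<beta>) auto
        next
          case (Binary R y z)
          then obtain w w' where w: "\<beta> = Binary R w w'" "\<mu> y = tag \<rho> a b w" "\<mu> z = tag \<rho> a b w'"
            using \<beta>(2) by (cases \<beta>) auto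
          have "adj \<rho> w w'" using \<beta>(1) w(1) by (auto simp: adj_def)
          then have "adj \<rho> w' w" by (rule adj_sym)
          have wn: "y = x \<Longrightarrow> w = n" "z = x \<Longrightarrow> w' = n" using w(2,3) x tag_Inr by metis+
          have "y \<noteq> x \<Longrightarrow> w = Ind 0"
            using Binary \<alpha>(2) wn(2) child(2)[OF Y x, of w] \<open>adj \<rho> w' w\<close> by auto
          moreover have "z \<noteq> x \<Longrightarrow> w' = Ind 0"
            using Binary \<alpha>(2) wn(1) child(2)[OF Y x, of w'] \<open>adj \<rho> w w'\<close> by auto
          ultimately show ?thesis using Binary w(1) wn by auto
        qed
        moreover have "map_atom h (map_atom (\<lambda>v. if v = x then n else Ind 0) \<alpha>) =
            map_atom (at_pair (c 0) (h n)) (map_atom (\<lambda>v. if v = x then 1 else 0) \<alpha>)"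
          unfolding atom.map_comp map_atom_eq_iff using h(2) by (simp add: at_pair_def)
        ultimately show ?thesis using h(3)[OF \<beta>(1)] by simp
      qed
      then have "\<forall>\<alpha>\<in>set (star q x). map_atom (at_pair (c 0) (h n)) \<alpha> \<in> I" by (auto simp: star_def)
      moreover have "range (at_pair (c 0) (h n)) \<subseteq> D"
        using h(1) by (auto simp: at_pair_def simp flip: h(2))
      ultimately show "sat_cq D I (CQ [0] (star q x)) (map c [0])"
        unfolding sat_cq_def by (intro exI[of _ "at_pair (c 0) (h n)"]) (simp add: at_pair_def)
    qed
    then have "\<rho> \<in> set (gs x)" using gs \<rho>(1) by blast
    moreover have "x \<notin> set (answer_vars q)" using ans x by auto
    ultimately show ?thesis
      unfolding foldable_def using w \<nu>'a generator_instance_ind(2)[OF \<rho>] by metis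
  qed
  have esc: "escapes q ge A x" if x: "x \<in> cq_vars q" "\<mu> x = Inr (\<rho>, a, b, n)" "\<not> Y x" for x \<rho> a b n
  proof -
    \<comment> \<open>A neighbour at an individual would make \<open>u\<close> selected, and a
      selected neighbour would force \<open>u\<close> to an individual; so the whole component stays
      among the nulls of one copy.\<close>
    have inv: "(\<exists>n. \<mu> v = Inr (\<rho>, a, b, n)) \<and> \<not> Y v" if "(x, v) \<in> conn q" for v
      using that unfolding conn_def
    proof (induction rule: rtrancl_induct)
      case base
      then show ?case using x by blast
    next
      case (step u v)
      then obtain n where n: "\<mu> u = Inr (\<rho>, a, b, n)" by blast
      show ?case
      proof (cases "u = v")
        case False
        then have uv: "nbr q u v" using step(2) nbrI by blast
        have notInl: "\<mu> v \<noteq> Inl i" for i using step(3) n uv by (auto simp: Y_def)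
        obtain w where "\<mu> v = tag \<rho> a b w" using nbr_adj[OF uv n] by blast
        then have "\<exists>n. \<mu> v = Inr (\<rho>, a, b, n)" using notInl by (auto simp: tag_def split: if_splits)
        moreover have "\<not> Y v" using Y_nbr[OF _ _ nbr_sym[OF uv]] n calculation by auto
        ultimately show ?thesis by blast
      qed (use step in blast)
    qed
    have \<rho>: "\<rho> \<in> gens T" "map_atom (at_pair a b) \<rho> \<in> A" using null[OF x(1,2)] by auto
    define un :: "nat + nat atom \<times> nat \<times> nat \<times> elem \<Rightarrow> elem" where "un y = snd (snd (snd (projr y)))" for y
    have "entails_cq TYPE('d) T {\<rho>} (CQ [] (component q x)) []"
      unfolding entails_cq_def
    proof (intro allI impI)
      fix D :: "'d set" and c I assume "is_model T {\<rho>} D c I"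
      then obtain h where h: "range h \<subseteq> D" "\<And>\<alpha>. \<alpha> \<in> can \<rho> \<Longrightarrow> map_atom h \<alpha> \<in> I"
        using can_universal[OF gens_generators[OF \<rho>(1)]] by metis
      have "map_atom (h \<circ> un \<circ> \<mu>) \<alpha> \<in> I" if \<alpha>: "\<alpha> \<in> set (component q x)" for \<alpha>
      proof -
        obtain v where v: "\<alpha> \<in> set (cq_atoms q)" "v \<in> set_atom \<alpha>" "(x, v) \<in> conn q"
          using \<alpha> by (auto simp: component_def)
        have Inr: "\<exists>n. \<mu> u = Inr (\<rho>, a, b, n)" if "u \<in> set_atom \<alpha>" for u
          using inv conn_trans[OF v(3) conn_atom[OF v(1,2) that]] by blast
        obtain \<beta> where \<beta>: "\<beta> \<in> can \<rho>" "map_atom \<mu> \<alpha> = map_atom (tag \<rho> a b) \<beta>"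
          using glued_Inr(5)[OF \<mu>[OF v(1)]] atom_in[OF v(2)] Inr[OF v(2)] by metis
        have "un (tag \<rho> a b w) = w" if "w \<in> set_atom \<beta>" for w
        proof -
          have "tag \<rho> a b w \<in> \<mu> ` set_atom \<alpha>" using that \<beta>(2) by (metis atom.set_map imageI)
          then obtain m where "tag \<rho> a b w = Inr (\<rho>, a, b, m)" using Inr by (metis imageE)
          then show ?thesis using tag_Inr[of \<rho> a b w m] by (simp add: un_def)
        qed
        then have "map_atom un (map_atom (tag \<rho> a b) \<beta>) = map_atom id \<beta>"
          unfolding atom.map_comp map_atom_eq_iff by simp
        then have "map_atom un (map_atom \<mu> \<alpha>) = \<beta>" using \<beta>(2) by (simp add: atom.map_id)
        then show ?thesis using h(2)[OF \<beta>(1)] by (auto simp: atom.map_comp comp_assoc)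
      qed
      then show "sat_cq D I (CQ [] (component q x)) (map c [])"
        unfolding sat_cq_def using h(1) by (intro exI[of _ "h \<circ> un \<circ> \<mu>"]) auto
    qed
    then have "\<rho> \<in> set (ge (component q x))" using ge \<rho>(1) by blast
    moreover have "(x, y) \<notin> conn q" if "y \<in> set (answer_vars q)" for y using inv ans[OF that] by fastforce
    ultimately show ?thesis unfolding escapes_def using generator_instance_ind[OF \<rho>] by blast
  qed
  have "selection q ge gs A \<nu>' Y"
    unfolding selection_def
  proof (intro conjI ballI allI impI notI)
    fix \<alpha> assume \<alpha>: "\<alpha> \<in> set (cq_atoms q)"
    then have vars: "set_atom \<alpha> \<subseteq> cq_vars q" by (auto simp: cq_vars_def)
    show "map_atom \<nu>' \<alpha> \<in> A \<or> (\<exists>u\<in>set_atom \<alpha>. escapes q ge A u \<or> Y u)"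
    proof (cases "\<exists>u\<in>set_atom \<alpha>. \<exists>y. \<mu> u = Inr y")
      case True
      then obtain u \<rho> a b n where "u \<in> set_atom \<alpha>" "\<mu> u = Inr (\<rho>, a, b, n)" by (metis prod.exhaust)
      then show ?thesis using esc[of u] vars by blast
    next
      case False
      have "\<mu> v = (Inl \<circ> \<nu>') v" if "v \<in> set_atom \<alpha>" for v
        using False that \<nu>'_Inl vars by (cases "\<mu> v") auto
      then have "map_atom \<mu> \<alpha> = map_atom Inl (map_atom \<nu>' \<alpha>)"
        unfolding atom.map_comp map_atom_eq_iff by blast
      then show ?thesis using glued_Inl[OF compl] \<mu>[OF \<alpha>] by metis
    qed
  next
    fix u v assume uv: "nbr q u v" "Y u \<and> Y v"
    obtain \<rho> a b n where u: "\<mu> u = Inr (\<rho>, a, b, n)" using uv by (metis Y_def prod.exhaust)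
    show False using Y_nbr[OF _ u uv(1)] uv(2) by (auto simp: Y_def)
  qed (use Y_fold in blast)
  moreover have "\<nu>' x \<in> ind A" if x: "x \<in> cq_vars q" for x
  proof (cases "\<mu> x")
    case (Inl i)
    obtain \<alpha> where "\<alpha> \<in> set (cq_atoms q)" "x \<in> set_atom \<alpha>" using x by (auto simp: cq_vars_def)
    then show ?thesis using glued_Inl_ind[OF \<mu>] atom_in \<nu>'_Inl[OF x Inl] Inl by metis
  next
    case (Inr y)
    obtain \<rho> a b n where y: "y = (\<rho>, a, b, n)" by (cases y)
    then have "\<nu>' x = a" using x ans Inr by (auto simp: \<nu>'_def)
    then show ?thesis using generator_instance_ind(1) null[OF x] Inr y by metis
  qed
  moreover have "\<nu>' x = \<nu> x" if "x \<notin> cq_vars q - set (answer_vars q)" for x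
    using that unfolding \<nu>'_def by (rule if_not_P)
  ultimately show ?thesis using that[of \<nu>' Y] by blast
qed

end

section \<open>The rewriting\<close>

fun atom_vars :: "nat atom \<Rightarrow> nat list" where
  "atom_vars (Unary P x) = [x]"
| "atom_vars (Binary R x y) = [x, y]"

definition var_list :: "cq \<Rightarrow> nat list" where
  "var_list q = remdups (concat (map atom_vars (cq_atoms q)))"

lemma set_var_list: "set (var_list q) = cq_vars q"
proof -
  have "set (atom_vars \<alpha>) = set_atom \<alpha>" for \<alpha> by (cases \<alpha>) auto
  then show ?thesis by (auto simp: var_list_def cq_vars_def)
qed

lemma distinct_var_list: "distinct (var_list q)"
  by (simp add: var_list_def)

lemma length_var_list: "length (var_list q) \<le> 2 * cq_size q"
proof -
  have "length (concat (map atom_vars \<alpha>s)) \<le> 2 * length \<alpha>s" for \<alpha>s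
  proof (induction \<alpha>s)
    case (Cons \<alpha> \<alpha>s)
    then show ?case by (cases \<alpha>) auto
  qed simp
  then show ?thesis unfolding var_list_def cq_size_def using length_remdups_leq order_trans by blast
qed

text \<open>The quantifiers bind the variables 0 and 1 of the generators themselves, so the formula
  is closed whatever the variables of the query.\<close>

definition escapes_fo :: "cq \<Rightarrow> (nat atom list \<Rightarrow> nat atom list) \<Rightarrow> nat \<Rightarrow> fo" where
  "escapes_fo q ge u = (if \<exists>x\<in>set (answer_vars q). (u, x) \<in> conn q then FFalse
     else FDisj (map (\<lambda>\<rho>. FEx 0 (FEx 1 (FAtom \<rho>))) (ge (component q u))))"

text \<open>All neighbours are compared with the first one, \<open>w\<close>; \<open>Suc w\<close>
  is merely some variable other than \<open>w\<close>.\<close>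

definition foldable_fo :: "cq \<Rightarrow> (nat \<Rightarrow> nat atom list) \<Rightarrow> nat \<Rightarrow> fo" where
  "foldable_fo q gs u = (if u \<in> set (answer_vars q) then FFalse
     else case filter (nbr q u) (var_list q) of [] \<Rightarrow> FFalse
     | w # ws \<Rightarrow> FAnd (FConj (map (FEq w) ws))
         (FDisj (map (\<lambda>\<rho>. FEx (Suc w) (FAtom (map_atom (at_pair w (Suc w)) \<rho>))) (gs u))))"

lemma fo_size_atom: "fo_size (FAtom \<alpha>) \<le> 3"
  by (cases \<alpha>) auto

lemma fo_sat_escapes:
  assumes "\<forall>\<rho>\<in>set (ge (component q u)). set_atom \<rho> \<subseteq> {0, 1}"
  shows "fo_sat (ind A) A \<nu> (escapes_fo q ge u) \<longleftrightarrow> escapes q ge A u"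
proof -
  have "map_atom (\<nu>(0 := a, 1 := b)) \<rho> = map_atom (at_pair a b) \<rho>" if "\<rho> \<in> set (ge (component q u))" for \<rho> a b
    unfolding map_atom_eq_iff using assms that by (auto simp: at_pair_def)
  then show ?thesis by (auto simp: escapes_fo_def escapes_def fo_sat_FDisj)
qed

lemma fo_sat_foldable:
  "fo_sat (ind A) A \<nu> (foldable_fo q gs u) \<longleftrightarrow> foldable q gs A \<nu> u"
proof (cases "filter (nbr q u) (var_list q)")
  case Nil
  have "v \<in> cq_vars q" if "nbr q u v" for v using that by (auto simp: nbr_def cq_vars_def)
  then have "\<not> nbr q u v" for v using Nil unfolding filter_empty_conv set_var_list by blast
  then show ?thesis using Nil by (simp add: foldable_fo_def foldable_def)
next
  case (Cons w ws)
  have "nbr q u v \<longleftrightarrow> v \<in> set (filter (nbr q u) (var_list q))" for v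
    unfolding set_filter set_var_list by (auto simp: nbr_def cq_vars_def)
  then have nbr: "nbr q u v \<longleftrightarrow> v = w \<or> v \<in> set ws" for v unfolding Cons by simp
  have "map_atom (\<nu>(Suc w := b)) (map_atom (at_pair w (Suc w)) \<rho>) = map_atom (at_pair (\<nu> w) b) \<rho>" for b \<rho>
    by (simp add: atom.map_comp comp_at_pair)
  then have "fo_sat (ind A) A \<nu> (foldable_fo q gs u) \<longleftrightarrow> u \<notin> set (answer_vars q) \<and> (\<forall>v\<in>set ws. \<nu> w = \<nu> v) \<and>
      (\<exists>\<rho>\<in>set (gs u). \<exists>b\<in>ind A. map_atom (at_pair (\<nu> w) b) \<rho> \<in> A)"
    using Cons by (auto simp: foldable_fo_def fo_sat_FConj fo_sat_FDisj)
  also have "\<dots> \<longleftrightarrow> foldable q gs A \<nu> u"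
    unfolding foldable_def nbr by metis
  finally show ?thesis .
qed

lemma fo_free_escapes:
  assumes "\<forall>\<rho>\<in>set (ge (component q u)). set_atom \<rho> \<subseteq> {0, 1}"
  shows "fo_free (escapes_fo q ge u) = {}"
  using assms by (auto simp: escapes_fo_def fo_free_FDisj)

lemma fo_free_foldable: "fo_free (foldable_fo q gs u) \<subseteq> cq_vars q"
proof (cases "filter (nbr q u) (var_list q)")
  case Nil
  then show ?thesis by (simp add: foldable_fo_def)
next
  case (Cons w ws)
  then have "set (w # ws) \<subseteq> cq_vars q" by (metis filter_is_subset set_var_list)
  then show ?thesis using Cons
    by (auto simp: foldable_fo_def fo_free_FConj fo_free_FDisj atom.set_map at_pair_def split: if_splits)
qed

lemma fo_size_escapes:
  assumes "length (ge (component q u)) \<le> 2 * k"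
  shows "fo_size (escapes_fo q ge u) \<le> 16 * k + 6"
proof -
  have "fo_size (FDisj (map (\<lambda>\<rho>. FEx 0 (FEx 1 (FAtom \<rho>))) (ge (component q u)))) \<le> (7 + 1) * (2 * k) + 6"
    by (rule order_trans[OF fo_size_FDisj[where k = 7]]) (use assms fo_size_atom in auto)
  then show ?thesis by (simp add: escapes_fo_def)
qed

lemma fo_size_foldable:
  assumes "length (gs u) \<le> 2 * k" "cq_size q \<le> k"
  shows "fo_size (foldable_fo q gs u) \<le> 20 * k + 12"
proof (cases "filter (nbr q u) (var_list q)")
  case Nil
  then show ?thesis by (simp add: foldable_fo_def)
next
  case (Cons w ws)
  have "length (w # ws) \<le> length (var_list q)" unfolding Cons[symmetric] by (rule length_filter_le)
  then have "length ws \<le> 2 * k" using length_var_list[of q] assms(2) by simp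
  then have "fo_size (FConj (map (FEq w) ws)) \<le> (3 + 1) * (2 * k) + 5"
    by (intro order_trans[OF fo_size_FConj[where k = 3]]) auto
  moreover have "fo_size (FDisj (map (\<lambda>\<rho>. FEx (Suc w) (FAtom (map_atom (at_pair w (Suc w)) \<rho>))) (gs u))) \<le> (5 + 1) * (2 * k) + 6"
    by (rule order_trans[OF fo_size_FDisj[where k = 5]]) (use assms fo_size_atom in auto)
  ultimately show ?thesis using Cons by (simp add: foldable_fo_def)
qed

text \<open>The literals of the 2-CNF expressing that there is a selection are numbered: \<open>2 i + 1\<close> says
  that the \<open>i\<close>-th variable is selected and \<open>2 i\<close> says that it is not.\<close>

definition neg_lit :: "nat \<Rightarrow> nat" where
  "neg_lit i = (if even i then i + 1 else i - 1)"

text \<open>An edge from an even to an odd literal is the clause of an atom missing from the data, a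
  unit clause if \<open>u = v\<close>. An edge from an odd to an even one forbids selecting two
  neighbours or, if \<open>u = v\<close>, a variable that is not foldable.\<close>

definition edge_fo :: "cq \<Rightarrow> (nat atom list \<Rightarrow> nat atom list) \<Rightarrow> (nat \<Rightarrow> nat atom list) \<Rightarrow> nat \<Rightarrow> nat \<Rightarrow> fo" where
  "edge_fo q ge gs i j = (let u = var_list q ! (i div 2); v = var_list q ! (j div 2) in
     if even i \<and> odd j then FAnd (FNot (FOr (escapes_fo q ge u) (escapes_fo q ge v)))
       (FDisj (map (\<lambda>\<alpha>. FNot (FAtom \<alpha>)) (filter (\<lambda>\<alpha>. set_atom \<alpha> = {u, v}) (cq_atoms q))))
     else if odd i \<and> even j then if u = v then FNot (foldable_fo q gs u)
       else if nbr q u v then FTrue else FFalse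
     else FFalse)"

lemma fo_sat_edge:
  assumes "\<forall>\<beta>s. \<forall>\<rho>\<in>set (ge \<beta>s). set_atom \<rho> \<subseteq> {0, 1}"
  shows "fo_sat (ind A) A \<nu> (edge_fo q ge gs i j) \<longleftrightarrow>
    (let u = var_list q ! (i div 2); v = var_list q ! (j div 2) in
      even i \<and> odd j \<and> \<not> escapes q ge A u \<and> \<not> escapes q ge A v \<and>
        (\<exists>\<alpha>\<in>set (cq_atoms q). set_atom \<alpha> = {u, v} \<and> map_atom \<nu> \<alpha> \<notin> A) \<or>
      odd i \<and> even j \<and> (if u = v then \<not> foldable q gs A \<nu> u else nbr q u v))"
  using assms by (auto simp: edge_fo_def Let_def fo_sat_FDisj fo_sat_escapes fo_sat_foldable)

lemma fo_free_edge:
  assumes "\<forall>\<beta>s. \<forall>\<rho>\<in>set (ge \<beta>s). set_atom \<rho> \<subseteq> {0, 1}"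
  shows "fo_free (edge_fo q ge gs i j) \<subseteq> cq_vars q"
  using assms fo_free_foldable[of q gs]
  by (auto simp: edge_fo_def Let_def fo_free_FDisj fo_free_escapes) (auto simp: cq_vars_def)

text \<open>The longest edge has two formulas \<open>escapes_fo\<close> of size at most
  \<open>16 * k + 6\<close>, a disjunction of size at most \<open>5 * k + 6\<close> and three
  connectives.\<close>

lemma fo_size_edge:
  assumes "\<And>\<beta>s. length (ge \<beta>s) \<le> 2 * k" "\<And>u. length (gs u) \<le> 2 * k" "cq_size q \<le> k"
  shows "fo_size (edge_fo q ge gs i j) \<le> 37 * k + 21"
proof -
  have disj: "fo_size (FDisj (map (\<lambda>\<alpha>. FNot (FAtom \<alpha>)) (filter P (cq_atoms q)))) \<le> (4 + 1) * k + 6" for P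
  proof (rule order_trans[OF fo_size_FDisj[where k = 4]])
    have "length (filter P (cq_atoms q)) \<le> k"
      by (rule order_trans[OF length_filter_le assms(3)[unfolded cq_size_def]])
    then show "(4 + 1) * length (map (\<lambda>\<alpha>. FNot (FAtom \<alpha>)) (filter P (cq_atoms q))) + 6 \<le> (4 + 1) * k + 6" by simp
  qed (use fo_size_atom in auto)
  have esc: "fo_size (escapes_fo q ge u) \<le> 16 * k + 6" for u
    using assms(1) by (rule fo_size_escapes)
  have fold: "fo_size (foldable_fo q gs u) \<le> 20 * k + 12" for u
    using assms(2,3) by (rule fo_size_foldable)
  let ?u = "var_list q ! (i div 2)" and ?v = "var_list q ! (j div 2)"
  show ?thesis
    using disj[of "\<lambda>\<alpha>. set_atom \<alpha> = {?u, ?v}"] esc[of ?u] esc[of ?v] fold[of ?v]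
    unfolding edge_fo_def Let_def by simp
qed

text \<open>An instance of \<open>two_sat\<close>, with a selection read as the set of its true
  literals. The edges come in contrapositive pairs since an atom constrains an unordered pair of
  variables and \<open>nbr\<close> is symmetric.\<close>

lemma ex_selection_iff:
  fixes q :: cq and A :: "nat atom set" and \<nu> :: "nat \<Rightarrow> nat"
    and ge :: "nat atom list \<Rightarrow> nat atom list" and gs :: "nat \<Rightarrow> nat atom list"
  assumes ge: "\<forall>\<beta>s. \<forall>\<rho>\<in>set (ge \<beta>s). set_atom \<rho> \<subseteq> {0, 1}"
  defines "L \<equiv> {..<2 * length (var_list q)}"
  defines "E \<equiv> {(i, j). i < 2 * length (var_list q) \<and> j < 2 * length (var_list q) \<and>
    fo_sat (ind A) A \<nu> (edge_fo q ge gs i j)}"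
  shows "(\<exists>Y. selection q ge gs A \<nu> Y) \<longleftrightarrow>
    \<not> (\<exists>x\<in>L. (x, neg_lit x) \<in> E\<^sup>* \<and> (neg_lit x, x) \<in> E\<^sup>*)"
proof -
  let ?vs = "var_list q"
  let ?m = "length ?vs"
  let ?var = "\<lambda>i. ?vs ! (i div 2)"
  have E_iff: "(i, j) \<in> E \<longleftrightarrow> i \<in> L \<and> j \<in> L \<and>
      (even i \<and> odd j \<and> \<not> escapes q ge A (?var i) \<and> \<not> escapes q ge A (?var j) \<and>
        (\<exists>\<alpha>\<in>set (cq_atoms q). set_atom \<alpha> = {?var i, ?var j} \<and> map_atom \<nu> \<alpha> \<notin> A) \<or>
      odd i \<and> even j \<and> (if ?var i = ?var j then \<not> foldable q gs A \<nu> (?var i) else nbr q (?var i) (?var j)))" for i j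
    by (simp add: E_def L_def fo_sat_edge[OF ge] Let_def)
  have neg_even: "even (neg_lit i) \<longleftrightarrow> odd i" for i by (auto simp: neg_lit_def)
  have neg_div: "neg_lit i div 2 = i div 2" for i by (auto simp: neg_lit_def elim!: oddE)
  have neg_neg: "neg_lit (neg_lit i) = i" for i by (auto simp: neg_lit_def)
  have neg_L: "neg_lit i \<in> L" if "i \<in> L" for i using that by (auto simp: neg_lit_def L_def elim!: evenE)
  have sat: "(\<exists>S. (\<forall>x\<in>L. x \<in> S \<longleftrightarrow> neg_lit x \<notin> S) \<and> E `` S \<subseteq> S) \<longleftrightarrow>
      \<not> (\<exists>x\<in>L. (x, neg_lit x) \<in> E\<^sup>* \<and> (neg_lit x, x) \<in> E\<^sup>*)"
  proof (rule two_sat)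
    show "(neg_lit j, neg_lit i) \<in> E" if "(i, j) \<in> E" for i j
      using that unfolding E_iff neg_even neg_div
      by (auto simp: neg_L insert_commute split: if_splits dest: nbr_sym)
  qed (auto simp: neg_L neg_neg E_iff, simp add: L_def)
  have sel: "(\<exists>S. (\<forall>x\<in>L. x \<in> S \<longleftrightarrow> neg_lit x \<notin> S) \<and> E `` S \<subseteq> S) \<longleftrightarrow> (\<exists>Y. selection q ge gs A \<nu> Y)"
  proof
    assume "\<exists>Y. selection q ge gs A \<nu> Y"
    then obtain Y where Y: "selection q ge gs A \<nu> Y" by blast
    define S where "S = {i \<in> L. odd i \<longleftrightarrow> Y (?var i)}"
    have "x \<in> S \<longleftrightarrow> neg_lit x \<notin> S" if "x \<in> L" for x
      using that neg_L by (auto simp: S_def neg_even neg_div)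
    moreover have "j \<in> S" if ij: "(i, j) \<in> E" "i \<in> S" for i j
    proof -
      have L: "j \<in> L" using ij(1) by (simp add: E_iff)
      from ij(1) consider (pos) \<alpha> where "even i" "odd j" "\<not> escapes q ge A (?var i)" "\<not> escapes q ge A (?var j)"
          "\<alpha> \<in> set (cq_atoms q)" "set_atom \<alpha> = {?var i, ?var j}" "map_atom \<nu> \<alpha> \<notin> A"
        | (neg) "odd i" "even j" "if ?var i = ?var j then \<not> foldable q gs A \<nu> (?var i) else nbr q (?var i) (?var j)"
        unfolding E_iff by blast
      then show ?thesis
      proof cases
        case pos
        then have "Y (?var i) \<or> Y (?var j)" using Y unfolding selection_def by fastforce
        then show ?thesis using pos(1,2) ij(2) L by (simp add: S_def)
      next
        case neg
        then have "Y (?var i)" using ij(2) by (simp add: S_def)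
        then have "\<not> Y (?var j)" using Y neg(3) unfolding selection_def by metis
        then show ?thesis using neg(2) L by (simp add: S_def)
      qed
    qed
    ultimately show "\<exists>S. (\<forall>x\<in>L. x \<in> S \<longleftrightarrow> neg_lit x \<notin> S) \<and> E `` S \<subseteq> S"
      by (intro exI[of _ S] conjI ballI subsetI) auto
  next
    assume "\<exists>S. (\<forall>x\<in>L. x \<in> S \<longleftrightarrow> neg_lit x \<notin> S) \<and> E `` S \<subseteq> S"
    then obtain S where S_neg: "\<forall>x\<in>L. x \<in> S \<longleftrightarrow> neg_lit x \<notin> S" and S_closed: "E `` S \<subseteq> S"
      by (elim exE conjE)
    have cl: "j \<in> S" if "(i, j) \<in> E" "i \<in> S" for i j
      using S_closed ImageI[OF that] by (rule subsetD)
    define Y where "Y v \<longleftrightarrow> (\<exists>i<?m. v = ?vs ! i \<and> 2 * i + 1 \<in> S)" for v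
    have S2: "2 * i \<in> S \<longleftrightarrow> 2 * i + 1 \<notin> S" if "i < ?m" for i
      using bspec[OF S_neg, of "2 * i"] that by (simp add: L_def neg_lit_def)
    have Y_nth: "Y (?vs ! i) \<longleftrightarrow> 2 * i + 1 \<in> S" if "i < ?m" for i
      using that distinct_var_list[of q] by (auto simp: Y_def nth_eq_iff_index_eq)
    have index: "\<exists>i<?m. v = ?vs ! i" if "v \<in> cq_vars q" for v
      using that by (metis in_set_conv_nth set_var_list)
    have "selection q ge gs A \<nu> Y"
      unfolding selection_def
    proof (intro conjI ballI allI impI notI)
      fix \<alpha> assume \<alpha>: "\<alpha> \<in> set (cq_atoms q)"
      obtain u v where uv: "set_atom \<alpha> = {u, v}" by (cases \<alpha>) auto
      then obtain i j where ij: "i < ?m" "u = ?vs ! i" "j < ?m" "v = ?vs ! j"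
        using index \<alpha> by (metis UN_I cq_vars_def insertI1 insertI2)
      show "map_atom \<nu> \<alpha> \<in> A \<or> (\<exists>u\<in>set_atom \<alpha>. escapes q ge A u \<or> Y u)"
      proof (rule ccontr)
        assume neg: "\<not> ?thesis"
        then have "(2 * i, 2 * j + 1) \<in> E"
          unfolding E_iff using ij uv \<alpha> by (auto simp: L_def)
        then have "2 * i + 1 \<in> S \<or> 2 * j + 1 \<in> S" using cl S2[OF ij(1)] by blast
        then show False using neg uv ij Y_nth by auto
      qed
    next
      fix u assume "Y u"
      then obtain i where i: "i < ?m" "u = ?vs ! i" "2 * i + 1 \<in> S" by (auto simp: Y_def)
      show "foldable q gs A \<nu> u"
      proof (rule ccontr)
        assume "\<not> foldable q gs A \<nu> u"
        then have "(2 * i + 1, 2 * i) \<in> E" unfolding E_iff using i by (auto simp: L_def)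
        then show False using cl i S2 by blast
      qed
    next
      fix u v assume uv: "nbr q u v" "Y u \<and> Y v"
      then obtain i j where ij: "i < ?m" "u = ?vs ! i" "2 * i + 1 \<in> S" "j < ?m" "v = ?vs ! j" "2 * j + 1 \<in> S"
        by (auto simp: Y_def)
      have "(2 * i + 1, 2 * j) \<in> E" unfolding E_iff using ij uv(1) by (auto simp: L_def nbr_def)
      then show False using cl ij S2 by blast
    qed
    then show "\<exists>Y. selection q ge gs A \<nu> Y" by blast
  qed
  show ?thesis unfolding sel[symmetric] by (rule sat)
qed

section \<open>Correctness and size of the rewriting\<close>

lemma finite_unary_preds:
  assumes "finite T"
  shows "finite (unary_preds T)"
proof (rule finite_subset)
  let ?pred = "\<lambda>\<alpha> :: nat atom. case \<alpha> of Unary P x \<Rightarrow> P | Binary R x y \<Rightarrow> R"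
  show "unary_preds T \<subseteq> (\<Union>\<tau>\<in>T. ?pred ` insert (body \<tau>) (set (head \<tau>)))"
  proof
    fix P assume "P \<in> unary_preds T"
    then obtain \<tau> x where "\<tau> \<in> T" "Unary P x \<in> insert (body \<tau>) (set (head \<tau>))"
      unfolding unary_preds_def by blast
    then show "P \<in> (\<Union>\<tau>\<in>T. ?pred ` insert (body \<tau>) (set (head \<tau>)))"
      by (intro UN_I[of \<tau>] rev_image_eqI[of "Unary P x"]) simp_all
  qed
qed (use assms in simp)

theorem NL_poly_subset_NC1_imp_rewritings:
  assumes inf: "infinite (UNIV :: 'd set)" and sub: "NL_poly \<subseteq> NC1"
  shows "\<exists>p :: nat poly. \<forall>q T. wf_cq q \<longrightarrow> ontology T \<longrightarrow> of_depth T 1 \<longrightarrow>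
    (\<exists>q'. fo_rewriting TYPE('d) q T q' \<and> fo_size q' \<le> poly p (cq_size q + ontology_size T))"
proof -
  obtain p :: "nat poly" where p: "\<forall>N (\<epsilon> :: nat \<Rightarrow> nat \<Rightarrow> fo) k s t. (\<forall>i<N. \<forall>j<N. fo_size (\<epsilon> i j) \<le> k) \<longrightarrow> s < N \<longrightarrow> t < N \<longrightarrow>
    (\<exists>\<phi>. fo_free \<phi> \<subseteq> (\<Union>i<N. \<Union>j<N. fo_free (\<epsilon> i j)) \<and> fo_size \<phi> \<le> (k + 12) * poly p N \<and>
      (\<forall>D (I :: nat atom set) \<nu>. fo_sat D I \<nu> \<phi> \<longleftrightarrow>
        (s, t) \<in> {(i, j). i < N \<and> j < N \<and> fo_sat D I \<nu> (\<epsilon> i j)}\<^sup>*))"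
    using fo_reachability[OF sub] by (elim exE)
  \<comment> \<open>At most \<open>2 * k\<close> quantifiers, a negation and \<open>FFalse\<close>
    give \<open>4 * k + 7\<close>; each of at most \<open>4 * k\<close> literals contributes two
    reachability formulas and two connectives.\<close>
  let ?P = "[:7, 4:] + [:0, 4:] * (2 * [:33, 37:] * pcompose p [:0, 4:] + 2)"
  have "\<exists>q'. fo_rewriting TYPE('d) q T q' \<and> fo_size q' \<le> poly ?P (cq_size q + ontology_size T)"
    if wf: "wf_cq q" and onto: "ontology T" and depth: "of_depth T 1" for q T
  proof -
    define k where "k = cq_size q + ontology_size T"
    have "finite T" using onto by (simp add: ontology_def)
    then have "finite (unary_preds T)" by (rule finite_unary_preds)
    then obtain F where F: "F \<notin> unary_preds T" using ex_new_if_finite[OF infinite_UNIV_nat] by blast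
    interpret shallow T F
      using onto depth F by unfold_locales (auto simp: of_depth_def)
    obtain gl where gl: "set gl = gens T" "length gl \<le> 2 * ontology_size T"
      using gens_list[OF \<open>finite T\<close>] by blast
    \<comment> \<open>Filtering by entailment makes the hypotheses of \<open>selection_sound\<close>
      and \<open>selection_complete\<close> hold by definition.\<close>
    define ge where "ge \<beta>s = filter (\<lambda>\<rho>. entails_cq TYPE('d) T {\<rho>} (CQ [] \<beta>s) []) gl" for \<beta>s
    define gs where "gs u = filter (\<lambda>\<rho>. entails_cq TYPE('d) T {\<rho>} (CQ [0] (star q u)) [0]) gl" for u
    have ge_vars: "\<forall>\<beta>s. \<forall>\<rho>\<in>set (ge \<beta>s). set_atom \<rho> \<subseteq> {0, 1}"
      using generator_vars gens_generators gl(1) by (fastforce simp: ge_def)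
    have len: "length (ge \<beta>s) \<le> 2 * k" "length (gs u) \<le> 2 * k" for \<beta>s u
      using gl(2) length_filter_le[of _ gl] unfolding ge_def gs_def k_def
      by (meson le_add2 mult_le_mono2 order_trans)+
    define N where "N = 2 * length (var_list q)"
    have N: "N \<le> 4 * k" using length_var_list[of q] by (simp add: N_def k_def)
    have edge: "fo_size (edge_fo q ge gs i j) \<le> 37 * k + 21" for i j
      by (rule fo_size_edge[OF len]) (simp add: k_def)
    let ?good = "\<lambda>s t \<phi>. fo_free \<phi> \<subseteq> cq_vars q \<and> fo_size \<phi> \<le> (37 * k + 33) * poly p N \<and>
      (\<forall>D (I :: nat atom set) \<nu>. fo_sat D I \<nu> \<phi> \<longleftrightarrow>
        (s, t) \<in> {(i, j). i < N \<and> j < N \<and> fo_sat D I \<nu> (edge_fo q ge gs i j)}\<^sup>*)"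
    have ex_R: "\<exists>\<phi>. ?good s t \<phi>" if st: "s < N" "t < N" for s t
    proof -
      obtain \<phi> where \<phi>: "fo_free \<phi> \<subseteq> (\<Union>i<N. \<Union>j<N. fo_free (edge_fo q ge gs i j))"
        "fo_size \<phi> \<le> (37 * k + 21 + 12) * poly p N"
        "\<forall>D (I :: nat atom set) \<nu>. fo_sat D I \<nu> \<phi> \<longleftrightarrow>
          (s, t) \<in> {(i, j). i < N \<and> j < N \<and> fo_sat D I \<nu> (edge_fo q ge gs i j)}\<^sup>*"
        using p[rule_format, of N "edge_fo q ge gs" "37 * k + 21" s t, OF edge st] by (elim exE conjE)
      have "(\<Union>i<N. \<Union>j<N. fo_free (edge_fo q ge gs i j)) \<subseteq> cq_vars q"
        using fo_free_edge[OF ge_vars] by (intro UN_least)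
      then have "fo_free \<phi> \<subseteq> cq_vars q" using \<phi>(1) by (rule order_trans[rotated])
      moreover have "fo_size \<phi> \<le> (37 * k + 33) * poly p N" using \<phi>(2) by (simp add: add.commute)
      ultimately show ?thesis using \<phi>(3) by (intro exI[of _ \<phi>] conjI)
    qed
    define R where "R s t = (SOME \<phi>. ?good s t \<phi>)" for s t
    have R: "?good s t (R s t)" if "s < N" "t < N" for s t
      unfolding R_def by (rule someI_ex[OF ex_R[OF that]])
    have neg_N: "neg_lit x < N" if "x < N" for x
      using that by (auto simp: neg_lit_def N_def elim!: evenE)
    define cyc where "cyc x = FAnd (R x (neg_lit x)) (R (neg_lit x) x)" for x
    define ex where "ex = filter (\<lambda>x. x \<notin> set (answer_vars q)) (var_list q)"
    define q' where "q' = FExs ex (FNot (FDisj (map cyc [0..<N])))"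
    have ex: "set ex = cq_vars q - set (answer_vars q)" by (auto simp: ex_def set_var_list)
    have "fo_free (cyc x) \<subseteq> cq_vars q" if "x < N" for x
      using R neg_N that by (simp add: cyc_def)
    then have "fo_free q' \<subseteq> set (answer_vars q)"
      unfolding q'_def fo_free_FExs ex by (fastforce simp: fo_free_FDisj)
    moreover have "entails_cq TYPE('d) T A q (map \<nu> (answer_vars q)) \<longleftrightarrow> fo_sat (ind A) A \<nu> q'"
      if compl: "complete_instance TYPE('d) T A" and \<nu>: "\<nu> ` set (answer_vars q) \<subseteq> ind A" for A \<nu>
    proof -
      have body: "fo_sat (ind A) A \<nu>' (FNot (FDisj (map cyc [0..<N]))) \<longleftrightarrow> (\<exists>Y. selection q ge gs A \<nu>' Y)" for \<nu>'
        unfolding ex_selection_iff[OF ge_vars] N_def[symmetric]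
        using R neg_N by (auto simp: fo_sat_FDisj cyc_def)
      have "fo_sat (ind A) A \<nu> q' \<longleftrightarrow> (\<exists>\<nu>'. (\<forall>x. x \<notin> cq_vars q - set (answer_vars q) \<longrightarrow> \<nu>' x = \<nu> x) \<and>
          \<nu>' ` (cq_vars q - set (answer_vars q)) \<subseteq> ind A \<and> (\<exists>Y. selection q ge gs A \<nu>' Y))"
        unfolding q'_def fo_sat_FExs body ex ..
      also have "\<dots> \<longleftrightarrow> entails_cq TYPE('d) T A q (map \<nu> (answer_vars q))"
      proof
        assume "entails_cq TYPE('d) T A q (map \<nu> (answer_vars q))"
        moreover have "\<rho> \<in> set (ge \<beta>s)" if "\<rho> \<in> gens T" "entails_cq TYPE('d) T {\<rho>} (CQ [] \<beta>s) []" for \<rho> \<beta>s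
          using that gl(1) by (simp add: ge_def)
        moreover have "\<rho> \<in> set (gs u)" if "\<rho> \<in> gens T" "entails_cq TYPE('d) T {\<rho>} (CQ [0] (star q u)) [0]" for \<rho> u
          using that gl(1) by (simp add: gs_def)
        ultimately obtain \<nu>' Y where "\<And>x. x \<notin> cq_vars q - set (answer_vars q) \<Longrightarrow> \<nu>' x = \<nu> x"
          "\<nu>' ` cq_vars q \<subseteq> ind A" "selection q ge gs A \<nu>' Y"
          using selection_complete[OF inf compl] by blast
        then show "\<exists>\<nu>'. (\<forall>x. x \<notin> cq_vars q - set (answer_vars q) \<longrightarrow> \<nu>' x = \<nu> x) \<and>
            \<nu>' ` (cq_vars q - set (answer_vars q)) \<subseteq> ind A \<and> (\<exists>Y. selection q ge gs A \<nu>' Y)"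
          by blast
      next
        assume "\<exists>\<nu>'. (\<forall>x. x \<notin> cq_vars q - set (answer_vars q) \<longrightarrow> \<nu>' x = \<nu> x) \<and>
            \<nu>' ` (cq_vars q - set (answer_vars q)) \<subseteq> ind A \<and> (\<exists>Y. selection q ge gs A \<nu>' Y)"
        then obtain \<nu>' Y where \<nu>': "\<forall>x. x \<notin> cq_vars q - set (answer_vars q) \<longrightarrow> \<nu>' x = \<nu> x"
          and Y: "selection q ge gs A \<nu>' Y" by blast
        have "entails_cq TYPE('d) T A q (map \<nu>' (answer_vars q))"
          by (rule selection_sound[OF _ _ Y]) (simp_all add: ge_def gs_def)
        moreover have "map \<nu>' (answer_vars q) = map \<nu> (answer_vars q)" using \<nu>' by simp
        ultimately show "entails_cq TYPE('d) T A q (map \<nu> (answer_vars q))" by simp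
      qed
      finally show ?thesis by simp
    qed
    ultimately have "fo_rewriting TYPE('d) q T q'" unfolding fo_rewriting_def by (intro conjI allI impI)
    moreover have "fo_size q' \<le> poly ?P k"
    proof -
      define r where "r = (37 * k + 33) * poly p (4 * k)"
      have "poly p N \<le> poly p (4 * k)" using N by (rule poly_nat_mono)
      then have "fo_size (R s t) \<le> r" if "s < N" "t < N" for s t
        using R[OF that] unfolding r_def by (meson mult_le_mono2 order_trans)
      then have cyc: "fo_size (cyc x) \<le> 1 + r + r" if "x < N" for x
        unfolding cyc_def using that neg_N[OF that] by (simp add: add_mono)
      have "fo_size (FDisj (map cyc [0..<N])) \<le> (1 + r + r + 1) * length (map cyc [0..<N]) + 6"
        by (rule fo_size_FDisj) (use cyc in auto)
      also have "\<dots> = (2 * r + 2) * N + 6" by (simp add: algebra_simps)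
      also have "\<dots> \<le> (2 * r + 2) * (4 * k) + 6" by (intro add_right_mono mult_le_mono2 N)
      finally have "fo_size (FDisj (map cyc [0..<N])) \<le> (2 * r + 2) * (4 * k) + 6" .
      moreover have "length ex \<le> 2 * k"
        using length_filter_le[of _ "var_list q"] length_var_list[of q] unfolding ex_def k_def
        by (meson le_add1 mult_le_mono2 order_trans)
      ultimately have "fo_size q' \<le> 4 * k + 1 + ((2 * r + 2) * (4 * k) + 6)"
        by (simp add: q'_def fo_size_FExs)
      also have "\<dots> = poly ?P k"
        by (simp add: poly_pcompose r_def algebra_simps)
      finally show ?thesis .
    qed
    ultimately show ?thesis unfolding k_def by (intro exI[of _ q'] conjI)
  qed
  then show ?thesis by (intro exI[of _ ?P] allI impI)
qed

theorem theorem13: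
  assumes "infinite (UNIV :: 'd set)"
  shows "(\<exists>p :: nat poly. \<forall>q T. wf_cq q \<longrightarrow> ontology T \<longrightarrow> of_depth T 1 \<longrightarrow>
            (\<exists>q'. fo_rewriting TYPE('d) q T q' \<and> fo_size q' \<le> poly p (cq_size q + ontology_size T)))
         \<longleftrightarrow> NL_poly \<subseteq> NC1"
  using rewritings_imp_NL_poly_subset_NC1[OF assms] NL_poly_subset_NC1_imp_rewritings[OF assms] by blast

end
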